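(* Let $(C,B,\phi)$ be a quasi coassociative coassociative pair (so $B$ is a Hopf coquasigroup, $C$ a Hopf algebra, $\phi:B\to C$), and assume that $B$ is commutative. Write $[c]:=\phi(c)$ for $c\in B$, and let $\mathrm{Ad}:C\to B\otimes C$, $\mathrm{Ad}([c])=[c]^{(-1)}\otimes[c]^{(0)}:=c_{(1)(1)}S_B(c_{(2)})\otimes[c_{(1)(2)}]=c_{(1)}S_B(c_{(2)(2)})\otimes[c_{(2)(1)}]$. Then $H=C\otimes B$, together with $B$, is a coherent Hopf 2-algebra with the structure maps given, for $b,b',c,c'\in B$, by \begin{align*} ([c]\otimes b)([c']\otimes b')&=[cc']\otimes bb',\\ \blacktriangle([c]\otimes b)&=[c]_{(1)}\otimes [c]_{(2)}{}^{(-1)}b_{(1)}\otimes [c]_{(2)}{}^{(0)}\otimes b_{(2)},\\ \epsilon_H([c]\otimes b)&=\epsilon_C([c])\epsilon_B(b),\\ S_H([c]\otimes b)&=S_C([c]^{(0)})\otimes S_B([c]^{(-1)}b),\\ s(b)&=\phi(b_{(1)})\otimes b_{(2)},\\ t(b)&=1\otimes b,\\ \Delta([c]\otimes b)&=([c]_{(1)}\otimes 1)\otimes_B([c]_{(2)}\otimes b),\\ \epsilon([c]\otimes b)&=\epsilon_C([c])\,b,\\ S([c]\otimes b)&=S_C([c])\phi(b_{(1)})\otimes b_{(2)},\\ \alpha([c]\otimes b)&=\beta(c)\,(b_{(1)(1)}\otimes b_{(1)(2)}\otimes b_{(2)}), \end{align*} where $\beta:B\to B\otimes B\otimes B$ is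 the comultiplicative coassociator of $B$.
   Context: All vector spaces are over $\mathbb{C}$. **Hopf coquasigroup.** A unital associative algebra $H$ with algebra homomorphisms $\Delta:H\to H\otimes H$, $\epsilon:H\to\mathbb{C}$ with $(\epsilon\otimes\mathrm{id})\Delta=\mathrm{id}=(\mathrm{id}\otimes\epsilon)\Delta$ ($\Delta$ not necessarily coassociative), and a linear map $S_H:H\to H$ with, writing $\Delta(h)=h_{(1)}\otimes h_{(2)}$ (sumless), $h_{(1)(1)}\otimes h_{(1)(2)}\otimes h_{(2)}=(\Delta\otimes\mathrm{id})\Delta(h)$, $h_{(1)}\otimes h_{(2)(1)}\otimes h_{(2)(2)}=(\mathrm{id}\otimes\Delta)\Delta(h)$, etc.: $S_H(h_{(1)})h_{(2)(1)}\otimes h_{(2)(2)}=1\otimes h=h_{(1)}S_H(h_{(2)(1)})\otimes h_{(2)(2)}$ and $h_{(1)(1)}\otimes S_H(h_{(1)(2)})h_{(2)}=h\otimes 1=h_{(1)(1)}\otimes h_{(1)(2)}S_H(h_{(2)})$. A morphism of Hopf coquasigroups is an algebra map compatible with coproducts and counits. The comultiplicative coassociator of $H$ is $\beta(h)=h_{(1)(1)}S_H(h_{(2)})_{(1)(1)}\otimes h_{(1)(2)(1)}S_H(h_{(2)})_{(1)(2)}\otimes h_{(1)(2)(2)}S_H(h_{(2)})_{(2)}$. "Commutative" refers to the algebra. **Coassociative pair** $(C,B,\phi)$: a Hopf coquasigroup $B$, a Hopf algebra $C$ and a Hopf coquasigroup morphism $\phi:B\to C$ such that after applying $\phi$ to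 any one (the first, or the second, or the third) of the three tensor legs, $(\Delta_B\otimes\mathrm{id})\Delta_B(b)$ and $(\mathrm{id}\otimes\Delta_B)\Delta_B(b)$ become equal, for all $b\in B$. **Quasi coassociative.** A coassociative pair $(C,B,\phi)$ is quasi coassociative if (1) $\phi$ is surjective; (2) for all $i\in I_B:=\ker\phi$: $i_{(1)(1)}S_B(i_{(2)})\otimes i_{(1)(2)}\in B\otimes I_B$ and $i_{(1)}S_B(i_{(2)(2)})\otimes i_{(2)(1)}\in B\otimes I_B$; (3) $I_B\subseteq\ker\beta$, where $\beta$ is the comultiplicative coassociator of $B$. (Hence $\mathrm{Ad}$ and $\alpha$ in the claim are well defined on classes $[c]$.) **Central Hopf algebroid over a commutative algebra $B$:** an algebra $H$ with algebra maps $s,t:B\to H$ and an anti-algebra map $S:H\to H$ such that: (1) the images of $s,t$ are central in $H$; (2) $(H,\Delta,\epsilon)$ is a $B$-coring for the bimodule structure $b\triangleright h\triangleleft b'=s(b)h\,t(b')$, i.e. $\Delta:H\to H\otimes_BH$ and $\epsilon:H\to B$ are $B$-bimodule maps that are coassociative and counital, where $g\otimes_B s(b)h=t(b)g\otimes_B h$; (3) $\Delta,\epsilon$ are algebra maps; (4) $S(t(b)hs(b'))=t(b')S(h)s(b)$; (5) $m(S\otimes_B\mathrm{id})\Delta=t\circ\epsilon$ and $m(\mathrm{id}\otimes_BS)\Delta=s\circ\epsilon$. **Coherent Hopf 2-algebra:** a commutative Hopf coquasigroup $(B,m_B,1_B,\Delta_B,\epsilon_B,S_B)$, a Hopf coquasigroup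 $(H,m,1_H,\blacktriangle,\epsilon_H,S_H)$, a central Hopf algebroid $(H,m,1_H,\Delta,\epsilon,S)$ over $B$ with source $s$ and target $t$, and an algebra map $\alpha:H\to B\otimes B\otimes B$ (coassociator), such that, writing $\blacktriangle(h)=h_{(1)}\otimes h_{(2)}$ and $\Delta(h)=h^{(1)}\otimes_Bh^{(2)}$: (i) the underlying algebras of the Hopf coquasigroup $H$ and the Hopf algebroid $H$ coincide; (ii) $\epsilon:H\to B$ and $s,t:B\to H$ are morphisms of Hopf coquasigroups; (iii) $h_{(1)}{}^{(1)}\otimes_Bh_{(1)}{}^{(2)}\otimes h_{(2)}{}^{(1)}\otimes_Bh_{(2)}{}^{(2)}=h^{(1)}{}_{(1)}\otimes_Bh^{(2)}{}_{(1)}\otimes h^{(1)}{}_{(2)}\otimes_Bh^{(2)}{}_{(2)}$ in $(H\otimes_BH)\otimes(H\otimes_BH)$; (iv) $\alpha\circ t=(\Delta_B\otimes\mathrm{id})\Delta_B$ and $\alpha\circ s=(\mathrm{id}\otimes\Delta_B)\Delta_B$; (v) $((s\otimes s\otimes s)\circ\alpha)\star((\blacktriangle\otimes\mathrm{id}_H)\circ\blacktriangle)=((\mathrm{id}_H\otimes\blacktriangle)\circ\blacktriangle)\star((t\otimes t\otimes t)\circ\alpha)$; (vi) $((\epsilon\otimes\alpha)\circ\blacktriangle)\star((\mathrm{id}_B\otimes\Delta_B\otimes\mathrm{id}_B)\circ\alpha)\star((\alpha\otimes\epsilon)\circ\blacktriangle)=((\mathrm{id}_B\otimes\mathrm{id}_B\otimes\Delta_B)\circ\alpha)\star((\Delta_B\otimes\mathrm{id}_B\otimes\mathrm{id}_B)\circ\alpha)$.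 Here $(f\star g)(h)=f(h^{(1)})g(h^{(2)})$ is the convolution with respect to the Hopf algebroid coproduct $\Delta$, for maps from $H$ into a common algebra (the products in (v),(vi) are well defined on $H\otimes_BH$ by (ii) and (iv)). *)

theory Defs
  imports Complex_Main "HOL-Library.Poly_Mapping"
begin

section \<open>Complex vector spaces and algebras\<close>

class complex_vector = ab_group_add +
  fixes scaleC :: "complex \<Rightarrow> 'a \<Rightarrow> 'a"  (infixr "*\<^sub>C" 75)
  assumes scaleC_add_right: "c *\<^sub>C (x + y) = c *\<^sub>C x + c *\<^sub>C y"
    and scaleC_add_left: "(c + d) *\<^sub>C x = c *\<^sub>C x + d *\<^sub>C x"
    and scaleC_scaleC: "c *\<^sub>C d *\<^sub>C x = (c * d) *\<^sub>C x"
    and scaleC_one: "1 *\<^sub>C x = x"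

text \<open>The axiom \<open>0 \<noteq> 1\<close> of \<^class>\<open>ring_1\<close> is harmless here: an algebra with a
  (unital) counit to the complex numbers is nonzero.\<close>

class complex_algebra_1 = complex_vector + ring_1 +
  assumes mult_scaleC_left: "(c *\<^sub>C x) * y = c *\<^sub>C (x * y)"
    and mult_scaleC_right: "x * (c *\<^sub>C y) = c *\<^sub>C (x * y)"

interpretation cvec: vector_space "scaleC :: complex \<Rightarrow> 'a \<Rightarrow> 'a::complex_vector"
  by unfold_locales (rule scaleC_add_right scaleC_add_left scaleC_scaleC scaleC_one)+

abbreviation cspan :: "'a::complex_vector set \<Rightarrow> 'a set"
  where "cspan \<equiv> module.span scaleC"

abbreviation clinear :: "('a::complex_vector \<Rightarrow> 'b::complex_vector) \<Rightarrow> bool"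
  where "clinear \<equiv> Vector_Spaces.linear scaleC scaleC"

lemma clinear_iff:
  "clinear f \<longleftrightarrow> (\<forall>x y. f (x + y) = f x + f y) \<and> (\<forall>c x. f (c *\<^sub>C x) = c *\<^sub>C f x)"
  by (simp add: Vector_Spaces.linear_iff cvec.vector_space_axioms)

definition cbilinear ::
    "('a::complex_vector \<Rightarrow> 'b::complex_vector \<Rightarrow> 'c::complex_vector) \<Rightarrow> bool"
  where "cbilinear f \<longleftrightarrow> (\<forall>a. clinear (f a)) \<and> (\<forall>b. clinear (\<lambda>a. f a b))"

definition alg_hom :: "('a::complex_algebra_1 \<Rightarrow> 'b::complex_algebra_1) \<Rightarrow> bool"
  where "alg_hom f \<longleftrightarrow> clinear f \<and> f 1 = 1 \<and> (\<forall>x y. f (x * y) = f x * f y)"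

definition alg_antihom :: "('a::complex_algebra_1 \<Rightarrow> 'b::complex_algebra_1) \<Rightarrow> bool"
  where "alg_antihom f \<longleftrightarrow> clinear f \<and> f 1 = 1 \<and> (\<forall>x y. f (x * y) = f y * f x)"

instantiation complex :: complex_algebra_1
begin
definition scaleC_complex :: "complex \<Rightarrow> complex \<Rightarrow> complex"
  where "scaleC_complex = (*)"
instance
  by standard (simp_all add: scaleC_complex_def algebra_simps)
end

instantiation poly_mapping :: (type, complex_vector) complex_vector
begin
lift_definition scaleC_poly_mapping :: "complex \<Rightarrow> ('a \<Rightarrow>\<^sub>0 'b) \<Rightarrow> ('a \<Rightarrow>\<^sub>0 'b)"
  is "\<lambda>c f x. c *\<^sub>C f x"
  by (rule finite_subset) auto
instance
  by standard
    (transfer, simp add: fun_eq_iff scaleC_add_right scaleC_add_left scaleC_scaleC scaleC_one)+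
end


section \<open>Tensor products over the complex numbers\<close>

text \<open>The free vector space on pairs modulo the bilinearity relations.\<close>

definition tensor_relators :: "('a::complex_vector \<times> 'b::complex_vector \<Rightarrow>\<^sub>0 complex) set"
  where "tensor_relators =
    {Poly_Mapping.single (a + a', b) 1
       - Poly_Mapping.single (a, b) 1 - Poly_Mapping.single (a', b) 1 | a a' b. True} \<union>
    {Poly_Mapping.single (a, b + b') 1
       - Poly_Mapping.single (a, b) 1 - Poly_Mapping.single (a, b') 1 | a b b'. True} \<union>
    {Poly_Mapping.single (c *\<^sub>C a, b) 1 - c *\<^sub>C Poly_Mapping.single (a, b) 1 | a b c. True} \<union>
    {Poly_Mapping.single (a, c *\<^sub>C b) 1 - c *\<^sub>C Poly_Mapping.single (a, b) 1 | a b c. True}"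

quotient_type (overloaded) ('a, 'b) tensor =
    "('a::complex_vector \<times> 'b::complex_vector) \<Rightarrow>\<^sub>0 complex" /
    "\<lambda>p q. p - q \<in> cspan tensor_relators"
proof (rule equivpI)
  show "reflp (\<lambda>p q. p - q \<in> cspan tensor_relators)"
    by (simp add: reflp_def cvec.span_zero)
  show "symp (\<lambda>p q. p - q \<in> cspan tensor_relators)"
    unfolding symp_def using cvec.span_neg by fastforce
  show "transp (\<lambda>p q. p - q \<in> cspan tensor_relators)"
    unfolding transp_def using cvec.span_add by fastforce
qed

type_notation tensor (infixr "\<otimes>" 75)

instantiation tensor :: (complex_vector, complex_vector) complex_vector
begin
lift_definition zero_tensor :: "'a \<otimes> 'b" is 0 .
lift_definition plus_tensor :: "'a \<otimes> 'b \<Rightarrow> 'a \<otimes> 'b \<Rightarrow> 'a \<otimes> 'b" is "(+)"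
  using cvec.span_add by (fastforce simp: add_diff_add)
lift_definition minus_tensor :: "'a \<otimes> 'b \<Rightarrow> 'a \<otimes> 'b \<Rightarrow> 'a \<otimes> 'b" is "(-)"
  subgoal for p p' q q'
    using cvec.span_diff[of "p - p'" _ "q - q'"] by (simp add: algebra_simps)
  done
lift_definition uminus_tensor :: "'a \<otimes> 'b \<Rightarrow> 'a \<otimes> 'b" is uminus
  subgoal for p q using cvec.span_neg[of "p - q"] by simp
  done
lift_definition scaleC_tensor :: "complex \<Rightarrow> 'a \<otimes> 'b \<Rightarrow> 'a \<otimes> 'b" is "scaleC"
  using cvec.span_scale by (fastforce simp flip: cvec.scale_right_diff_distrib)
instance
  by standard (transfer; simp add: algebra_simps cvec.span_zero)+
end

lift_definition tensor :: "'a::complex_vector \<Rightarrow> 'b::complex_vector \<Rightarrow> 'a \<otimes> 'b"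
    (infixr "\<otimes>" 68)
  is "\<lambda>a b. Poly_Mapping.single (a, b) 1" .

lemma tensor_add_left: "(a + a') \<otimes> b = a \<otimes> b + a' \<otimes> b"
  by transfer (rule cvec.span_base, unfold tensor_relators_def diff_diff_eq[symmetric], blast)

lemma tensor_add_right: "a \<otimes> (b + b') = a \<otimes> b + a \<otimes> b'"
  by transfer (rule cvec.span_base, unfold tensor_relators_def diff_diff_eq[symmetric], blast)

lemma tensor_scale_left: "(c *\<^sub>C a) \<otimes> b = c *\<^sub>C (a \<otimes> b)"
  by transfer (rule cvec.span_base, unfold tensor_relators_def, blast)

lemma tensor_scale_right: "a \<otimes> (c *\<^sub>C b) = c *\<^sub>C (a \<otimes> b)"
  by transfer (rule cvec.span_base, unfold tensor_relators_def, blast)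

lemma poly_mapping_single_scale:
  "Poly_Mapping.single k c = c *\<^sub>C Poly_Mapping.single k (1::complex)"
  by transfer (simp add: fun_eq_iff when_def scaleC_complex_def)

lemma tensor_induct [case_names tensor add]:
  assumes pure: "\<And>a b. P (a \<otimes> b)" and add: "\<And>x y. P x \<Longrightarrow> P y \<Longrightarrow> P (x + y)"
  shows "P (t :: 'a::complex_vector \<otimes> 'b::complex_vector)"
proof -
  have single: "abs_tensor (Poly_Mapping.single (a, b) c) = (c *\<^sub>C a) \<otimes> b"
    for a :: 'a and b :: 'b and c
  proof -
    have "abs_tensor (Poly_Mapping.single (a, b) c) =
        c *\<^sub>C abs_tensor (Poly_Mapping.single (a, b) 1)"
      unfolding scaleC_tensor.abs_eq by (simp only: poly_mapping_single_scale[of "(a, b)" c])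
    also have "\<dots> = c *\<^sub>C (a \<otimes> b)"
      by (simp only: tensor.abs_eq)
    finally show ?thesis
      by (simp only: tensor_scale_left)
  qed
  have "P (abs_tensor p)" for p :: "('a \<times> 'b) \<Rightarrow>\<^sub>0 complex"
  proof (induction p rule: update_induct)
    case const
    have "abs_tensor 0 = (0 :: 'a) \<otimes> (0 :: 'b)"
      using single[of 0 0 0] by simp
    then show ?case by (simp add: pure)
  next
    case (update p k c)
    have "Poly_Mapping.update k c p = p + Poly_Mapping.single k c"
      using update.hyps
      by (intro poly_mapping_eqI)
        (auto simp: lookup_update lookup_add lookup_single in_keys_iff when_def)
    then have "abs_tensor (Poly_Mapping.update k c p) =
        abs_tensor p + abs_tensor (Poly_Mapping.single k c)"
      by (simp add: plus_tensor.abs_eq)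
    then show ?case
      using update.IH by (cases k) (simp add: single pure add)
  qed
  from this[of "rep_tensor t"] show ?thesis
    by (simp add: Quotient3_abs_rep[OF Quotient3_tensor])
qed

text \<open>The linear map on the tensor product induced by a bilinear map.\<close>

definition tlift ::
    "('a::complex_vector \<Rightarrow> 'b::complex_vector \<Rightarrow> 'c::complex_vector) \<Rightarrow> 'a \<otimes> 'b \<Rightarrow> 'c"
  where "tlift f = (THE g. clinear g \<and> (\<forall>a b. g (a \<otimes> b) = f a b))"

lemma clinear_tensor_eqI:
  assumes "clinear f" "clinear g" "\<And>a b. f (a \<otimes> b) = g (a \<otimes> b)"
  shows "f = g"
proof
  show "f t = g t" for t
    by (induction t rule: tensor_induct) (use assms in \<open>simp_all add: clinear_iff\<close>)
qed

lemma tlift_ex: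
  assumes f: "cbilinear f"
  shows "\<exists>g. clinear g \<and> (\<forall>a b. g (a \<otimes> b) = f a b)"
proof -
  define F where "F p = (\<Sum>k\<in>Poly_Mapping.keys p. Poly_Mapping.lookup p k *\<^sub>C case_prod f k)" for p
  have F_single: "F (Poly_Mapping.single k c) = c *\<^sub>C case_prod f k" for k c
    by (simp add: F_def)
  have F_add: "F (p + q) = F p + F q" for p q
    unfolding F_def
    by (rule setsum_keys_plus_distrib) (simp_all add: cvec.scale_left_distrib)
  have F_scale: "F (c *\<^sub>C p) = c *\<^sub>C F p" for c p
  proof -
    have lookup: "Poly_Mapping.lookup (c *\<^sub>C p) k = c * Poly_Mapping.lookup p k" for k
      by transfer (simp add: scaleC_complex_def)
    have "F (c *\<^sub>C p) =
        (\<Sum>k\<in>Poly_Mapping.keys p. Poly_Mapping.lookup (c *\<^sub>C p) k *\<^sub>C case_prod f k)"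
      unfolding F_def
      by (rule sum.mono_neutral_left) (auto simp: in_keys_iff lookup)
    then show ?thesis
      by (simp add: F_def lookup cvec.scale_sum_right)
  qed
  have F_lin: "clinear F" by (simp add: clinear_iff F_add F_scale)
  interpret F: Vector_Spaces.linear scaleC scaleC F by (rule F_lin)
  have F_rel: "F r = 0" if "r \<in> tensor_relators" for r
  proof -
    have "f (a + a') b = f a b + f a' b" "f a (b + b') = f a b + f a b'"
      "f (c *\<^sub>C a) b = c *\<^sub>C f a b" "f a (c *\<^sub>C b) = c *\<^sub>C f a b" for a a' b b' c
      using f by (simp_all add: cbilinear_def clinear_iff)
    with that show ?thesis
      unfolding tensor_relators_def by (auto simp: F.diff F_single F_scale)
  qed
  have F_span: "F r = 0" if "r \<in> cspan tensor_relators" for r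
    by (rule F.eq_0_on_span[OF F_rel that])
  have F_cong: "F p = F q" if "p - q \<in> cspan tensor_relators" for p q
    using F_span[OF that] by (simp add: F.diff)
  define g where "g t = F (rep_tensor t)" for t
  have g_abs: "g (abs_tensor p) = F p" for p
    unfolding g_def
    by (rule F_cong) (simp add: Quotient3_rep_abs[OF Quotient3_tensor] cvec.span_zero)
  have abs_surj: "\<exists>p. x = abs_tensor p" for x :: "'a \<otimes> 'b"
    using Quotient3_abs_rep[OF Quotient3_tensor, of x] by (intro exI) (rule sym)
  have "g (x + y) = g x + g y" for x y
    using abs_surj[of x] abs_surj[of y] by (auto simp: g_abs F_add plus_tensor.abs_eq)
  moreover have "g (c *\<^sub>C x) = c *\<^sub>C g x" for c x
    using abs_surj[of x] by (auto simp: g_abs F_scale scaleC_tensor.abs_eq)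
  moreover have "g (a \<otimes> b) = f a b" for a b
    by (simp add: tensor.abs_eq g_abs F_single scaleC_one)
  ultimately show ?thesis unfolding clinear_iff by blast
qed

lemma
  assumes "cbilinear f"
  shows clinear_tlift: "clinear (tlift f)" and tlift_tensor: "tlift f (a \<otimes> b) = f a b"
proof -
  have "\<exists>!g. clinear g \<and> (\<forall>a b. g (a \<otimes> b) = f a b)"
  proof (rule ex_ex1I[OF tlift_ex[OF assms]])
    fix g h :: "'a \<otimes> 'b \<Rightarrow> 'c"
    assume "clinear g \<and> (\<forall>a b. g (a \<otimes> b) = f a b)" "clinear h \<and> (\<forall>a b. h (a \<otimes> b) = f a b)"
    then show "g = h" by (intro clinear_tensor_eqI) simp_all
  qed
  from theI'[OF this, folded tlift_def]
  show "clinear (tlift f)" "tlift f (a \<otimes> b) = f a b"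
    by blast+
qed

lemma ex_functional_1: "\<exists>f :: 'a::complex_algebra_1 \<Rightarrow> complex. clinear f \<and> f 1 = 1"
proof -
  interpret vp: vector_space_pair "scaleC :: _ \<Rightarrow> 'a \<Rightarrow> 'a" "scaleC :: _ \<Rightarrow> complex \<Rightarrow> complex" ..
  have "\<not> cvec.dependent {1 :: 'a}" by simp
  from vp.linear_construct[OF this] vp.construct_basis[OF this, of 1 "\<lambda>_. 1"]
  show ?thesis by blast
qed


subsection \<open>Tensor product algebras\<close>

instantiation tensor :: (complex_algebra_1, complex_algebra_1) complex_algebra_1
begin

definition one_tensor :: "'a \<otimes> 'b"
  where "1 = (1 :: 'a) \<otimes> (1 :: 'b)"

definition times_tensor :: "'a \<otimes> 'b \<Rightarrow> 'a \<otimes> 'b \<Rightarrow> 'a \<otimes> 'b"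
  where "x * y = tlift (\<lambda>a b. tlift (\<lambda>a' b'. (a * a') \<otimes> (b * b')) y) x"

lemma cbilinear_times_tensor_aux:
  "cbilinear (\<lambda>a' b'. (a * a' :: 'a) \<otimes> (b * b' :: 'b))"
  by (simp add: cbilinear_def clinear_iff distrib_left tensor_add_left tensor_add_right
      mult_scaleC_right tensor_scale_left tensor_scale_right)

lemma cbilinear_times_tensor_aux2:
  "cbilinear (\<lambda>a b. tlift (\<lambda>a' b'. (a * a' :: 'a) \<otimes> (b * b' :: 'b)) y)"
proof -
  define M where "M a b = tlift (\<lambda>a' b'. (a * a' :: 'a) \<otimes> (b * b' :: 'b))" for a b
  have M: "M a b (a' \<otimes> b') = (a * a') \<otimes> (b * b')"
    "M a b (x + z) = M a b x + M a b z" for a b a' b' x z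
    using tlift_tensor[OF cbilinear_times_tensor_aux, of a b]
      clinear_tlift[OF cbilinear_times_tensor_aux, of a b]
    by (simp_all add: M_def clinear_iff)
  note bilin = distrib_right tensor_add_left tensor_add_right mult_scaleC_left
    tensor_scale_left tensor_scale_right cvec.scale_right_distrib
  have "M (a1 + a2) b y = M a1 b y + M a2 b y" for a1 a2 b
    by (induction y rule: tensor_induct) (simp_all add: M bilin)
  moreover have "M a (b1 + b2) y = M a b1 y + M a b2 y" for a b1 b2
    by (induction y rule: tensor_induct) (simp_all add: M bilin)
  moreover have "M (c *\<^sub>C a) b y = c *\<^sub>C M a b y" for a b c
    by (induction y rule: tensor_induct) (simp_all add: M bilin)
  moreover have "M a (c *\<^sub>C b) y = c *\<^sub>C M a b y" for a b c
    by (induction y rule: tensor_induct) (simp_all add: M bilin)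
  ultimately show ?thesis
    unfolding M_def[symmetric] by (simp add: cbilinear_def clinear_iff)
qed

lemma times_tensor_tensor: "(a \<otimes> b) * (a' \<otimes> b') = (a * a' :: 'a) \<otimes> (b * b' :: 'b)"
  unfolding times_tensor_def tlift_tensor[OF cbilinear_times_tensor_aux2]
  by (rule tlift_tensor[OF cbilinear_times_tensor_aux])

lemma times_tensor_add_left: "(x + y) * z = x * z + y * (z :: 'a \<otimes> 'b)"
  and times_tensor_scale_left: "(c *\<^sub>C x) * z = c *\<^sub>C (x * (z :: 'a \<otimes> 'b))"
  using clinear_tlift[OF cbilinear_times_tensor_aux2[of z]]
  by (simp_all add: times_tensor_def clinear_iff)

lemma times_tensor_add_right: "z * (x + y) = z * x + z * (y :: 'a \<otimes> 'b)"
proof (induction z rule: tensor_induct)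
  case (tensor a b)
  show ?case
    using clinear_tlift[OF cbilinear_times_tensor_aux[of a b]]
    by (simp add: times_tensor_def tlift_tensor cbilinear_times_tensor_aux2 clinear_iff)
qed (simp add: times_tensor_add_left algebra_simps)

lemma times_tensor_scale_right: "z * (c *\<^sub>C x) = c *\<^sub>C (z * (x :: 'a \<otimes> 'b))"
proof (induction z rule: tensor_induct)
  case (tensor a b)
  show ?case
    using clinear_tlift[OF cbilinear_times_tensor_aux[of a b]]
    by (simp add: times_tensor_def tlift_tensor cbilinear_times_tensor_aux2 clinear_iff)
qed (simp add: times_tensor_add_left cvec.scale_right_distrib)

instance
proof
  fix x y z :: "'a \<otimes> 'b" and c :: complex
  show "(x * y) * z = x * (y * z)"
  proof (induction x rule: tensor_induct)
    case (tensor a b)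
    show ?case
    proof (induction y rule: tensor_induct)
      case (tensor a' b')
      show ?case
        by (induction z rule: tensor_induct)
          (simp_all add: times_tensor_tensor times_tensor_add_right mult.assoc)
    qed (simp add: times_tensor_add_left times_tensor_add_right)
  qed (simp add: times_tensor_add_left)
  show "1 * x = x"
    by (induction x rule: tensor_induct)
      (simp_all add: one_tensor_def times_tensor_tensor times_tensor_add_right)
  show "x * 1 = x"
    by (induction x rule: tensor_induct)
      (simp_all add: one_tensor_def times_tensor_tensor times_tensor_add_left)
  obtain f :: "'a \<Rightarrow> complex" and g :: "'b \<Rightarrow> complex"
    where f: "clinear f" "f 1 = 1" and g: "clinear g" "g 1 = 1"
    using ex_functional_1[where 'a = 'a] ex_functional_1[where 'a = 'b] by blast
  have bl: "cbilinear (\<lambda>a b. f a * g b)"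
    using f(1) g(1) unfolding cbilinear_def clinear_iff
    by (simp add: scaleC_complex_def algebra_simps)
  interpret h: Vector_Spaces.linear scaleC scaleC "tlift (\<lambda>a b. f a * g b)"
    by (rule clinear_tlift[OF bl])
  have "tlift (\<lambda>a b. f a * g b) 1 = 1"
    by (simp add: one_tensor_def tlift_tensor[OF bl] f g)
  then show "(0 :: 'a \<otimes> 'b) \<noteq> 1"
    using h.zero by (metis zero_neq_one)
qed (simp_all add: times_tensor_add_left times_tensor_add_right
    times_tensor_scale_left times_tensor_scale_right)

end


subsection \<open>Maps on tensor products\<close>

text \<open>Iterated tensor products are nested to the right, so \<open>B \<otimes> B \<otimes> B\<close> is
  \<open>B \<otimes> (B \<otimes> B)\<close>; \<open>tassoc\<close> is used to bring other bracketings into this form.\<close>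

definition tmap :: "('a::complex_vector \<Rightarrow> 'c::complex_vector) \<Rightarrow>
    ('b::complex_vector \<Rightarrow> 'd::complex_vector) \<Rightarrow> 'a \<otimes> 'b \<Rightarrow> 'c \<otimes> 'd"
  where "tmap f g = tlift (\<lambda>a b. f a \<otimes> g b)"

definition tassoc :: "('a::complex_vector \<otimes> 'b::complex_vector) \<otimes> 'c::complex_vector
    \<Rightarrow> 'a \<otimes> ('b \<otimes> 'c)"
  where "tassoc = tlift (\<lambda>x c. tlift (\<lambda>a b. a \<otimes> (b \<otimes> c)) x)"

definition tlift3 :: "('a::complex_vector \<Rightarrow> 'b::complex_vector \<Rightarrow> 'c::complex_vector \<Rightarrow>
    'd::complex_vector) \<Rightarrow> 'a \<otimes> 'b \<otimes> 'c \<Rightarrow> 'd"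
  where "tlift3 f = tlift (\<lambda>a. tlift (f a))"

text \<open>\<open>(a \<otimes> b) \<otimes> (c \<otimes> d) \<mapsto> (a \<otimes> c) \<otimes> (b \<otimes> d)\<close>\<close>

definition tswap_mid :: "('a::complex_vector \<otimes> 'b::complex_vector) \<otimes>
    ('c::complex_vector \<otimes> 'd::complex_vector) \<Rightarrow> ('a \<otimes> 'c) \<otimes> ('b \<otimes> 'd)"
  where "tswap_mid = tlift (\<lambda>x y. tlift (\<lambda>a b. tlift (\<lambda>c d. (a \<otimes> c) \<otimes> (b \<otimes> d)) y) x)"


section \<open>Hopf coquasigroups and Hopf algebras\<close>

text \<open>\<open>coprodL \<Delta> h\<close> is \<open>h\<^sub>(\<^sub>1\<^sub>)\<^sub>(\<^sub>1\<^sub>) \<otimes> h\<^sub>(\<^sub>1\<^sub>)\<^sub>(\<^sub>2\<^sub>) \<otimes> h\<^sub>(\<^sub>2\<^sub>)\<close> and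
  \<open>coprodR \<Delta> h\<close> is \<open>h\<^sub>(\<^sub>1\<^sub>) \<otimes> h\<^sub>(\<^sub>2\<^sub>)\<^sub>(\<^sub>1\<^sub>) \<otimes> h\<^sub>(\<^sub>2\<^sub>)\<^sub>(\<^sub>2\<^sub>)\<close>.\<close>

definition coprodL :: "('h::complex_vector \<Rightarrow> 'h \<otimes> 'h) \<Rightarrow> 'h \<Rightarrow> 'h \<otimes> 'h \<otimes> 'h"
  where "coprodL \<Delta> h = tassoc (tmap \<Delta> id (\<Delta> h))"

definition coprodR :: "('h::complex_vector \<Rightarrow> 'h \<otimes> 'h) \<Rightarrow> 'h \<Rightarrow> 'h \<otimes> 'h \<otimes> 'h"
  where "coprodR \<Delta> h = tmap id \<Delta> (\<Delta> h)"

locale counital_bialgebra =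
  fixes \<Delta> :: "'h::complex_algebra_1 \<Rightarrow> 'h \<otimes> 'h" and \<epsilon> :: "'h \<Rightarrow> complex"
  assumes coproduct_hom: "alg_hom \<Delta>"
    and counit_hom: "alg_hom \<epsilon>"
    and counit_left: "tlift (\<lambda>x y. \<epsilon> x *\<^sub>C y) (\<Delta> h) = h"
    and counit_right: "tlift (\<lambda>x y. \<epsilon> y *\<^sub>C x) (\<Delta> h) = h"

locale hopf_coquasigroup = counital_bialgebra \<Delta> \<epsilon>
  for \<Delta> :: "'h::complex_algebra_1 \<Rightarrow> 'h \<otimes> 'h" and \<epsilon> :: "'h \<Rightarrow> complex" +
  fixes S :: "'h \<Rightarrow> 'h"
  assumes antipode_linear: "clinear S"
    and antipode_R1: "tlift3 (\<lambda>x y z. (S x * y) \<otimes> z) (coprodR \<Delta> h) = 1 \<otimes> h"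
    and antipode_R2: "tlift3 (\<lambda>x y z. (x * S y) \<otimes> z) (coprodR \<Delta> h) = 1 \<otimes> h"
    and antipode_L1: "tlift3 (\<lambda>x y z. x \<otimes> (S y * z)) (coprodL \<Delta> h) = h \<otimes> 1"
    and antipode_L2: "tlift3 (\<lambda>x y z. x \<otimes> (y * S z)) (coprodL \<Delta> h) = h \<otimes> 1"

locale hopf_algebra = counital_bialgebra \<Delta> \<epsilon>
  for \<Delta> :: "'h::complex_algebra_1 \<Rightarrow> 'h \<otimes> 'h" and \<epsilon> :: "'h \<Rightarrow> complex" +
  fixes S :: "'h \<Rightarrow> 'h"
  assumes antipode_linear: "clinear S"
    and coassoc: "coprodL \<Delta> h = coprodR \<Delta> h"
    and antipode_left: "tlift (\<lambda>x y. S x * y) (\<Delta> h) = \<epsilon> h *\<^sub>C 1"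
    and antipode_right: "tlift (\<lambda>x y. x * S y) (\<Delta> h) = \<epsilon> h *\<^sub>C 1"

definition hopf_coquasigroup_hom ::
    "('a::complex_algebra_1 \<Rightarrow> 'a \<otimes> 'a) \<Rightarrow> ('a \<Rightarrow> complex) \<Rightarrow>
     ('b::complex_algebra_1 \<Rightarrow> 'b \<otimes> 'b) \<Rightarrow> ('b \<Rightarrow> complex) \<Rightarrow> ('a \<Rightarrow> 'b) \<Rightarrow> bool"
  where "hopf_coquasigroup_hom \<Delta> \<epsilon> \<Delta>' \<epsilon>' f \<longleftrightarrow>
    alg_hom f \<and> (\<forall>x. \<Delta>' (f x) = tmap f f (\<Delta> x)) \<and> (\<forall>x. \<epsilon>' (f x) = \<epsilon> x)"

text \<open>The comultiplicative coassociator: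
  \<open>\<beta>(h) = (h\<^sub>(\<^sub>1\<^sub>)\<^sub>(\<^sub>1\<^sub>) \<otimes> h\<^sub>(\<^sub>1\<^sub>)\<^sub>(\<^sub>2\<^sub>)\<^sub>(\<^sub>1\<^sub>) \<otimes> h\<^sub>(\<^sub>1\<^sub>)\<^sub>(\<^sub>2\<^sub>)\<^sub>(\<^sub>2\<^sub>)) \<cdot> (S(h\<^sub>(\<^sub>2\<^sub>))\<^sub>(\<^sub>1\<^sub>)\<^sub>(\<^sub>1\<^sub>) \<otimes> S(h\<^sub>(\<^sub>2\<^sub>))\<^sub>(\<^sub>1\<^sub>)\<^sub>(\<^sub>2\<^sub>) \<otimes> S(h\<^sub>(\<^sub>2\<^sub>))\<^sub>(\<^sub>2\<^sub>))\<close>,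
  a product in the algebra \<open>H \<otimes> H \<otimes> H\<close>.\<close>

definition coassociator ::
    "('h::complex_algebra_1 \<Rightarrow> 'h \<otimes> 'h) \<Rightarrow> ('h \<Rightarrow> 'h) \<Rightarrow> 'h \<Rightarrow> 'h \<otimes> 'h \<otimes> 'h"
  where "coassociator \<Delta> S h = tlift (\<lambda>x y. coprodR \<Delta> x * coprodL \<Delta> (S y)) (\<Delta> h)"


section \<open>Coassociative pairs of a Hopf algebra and a Hopf coquasigroup\<close>

locale coassociative_pair =
  B: hopf_coquasigroup \<Delta>B \<epsilon>B SB + C: hopf_algebra \<Delta>C \<epsilon>C SC
  for \<Delta>B :: "'b::complex_algebra_1 \<Rightarrow> 'b \<otimes> 'b" and \<epsilon>B SB
    and \<Delta>C :: "'c::complex_algebra_1 \<Rightarrow> 'c \<otimes> 'c" and \<epsilon>C SC +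
  fixes \<phi> :: "'b \<Rightarrow> 'c"
  assumes phi_hom: "hopf_coquasigroup_hom \<Delta>B \<epsilon>B \<Delta>C \<epsilon>C \<phi>"
    and coassoc_leg1: "tmap \<phi> id (coprodL \<Delta>B b) = tmap \<phi> id (coprodR \<Delta>B b)"
    and coassoc_leg2:
      "tmap id (tmap \<phi> id) (coprodL \<Delta>B b) = tmap id (tmap \<phi> id) (coprodR \<Delta>B b)"
    and coassoc_leg3:
      "tmap id (tmap id \<phi>) (coprodL \<Delta>B b) = tmap id (tmap id \<phi>) (coprodR \<Delta>B b)"

text \<open>The subspace \<open>B \<otimes> I\<close> of \<open>B \<otimes> B\<close> is \<open>cspan {x \<otimes> y | x y. y \<in> I}\<close>.\<close>

locale quasi_coassociative_pair = coassociative_pair \<Delta>B \<epsilon>B SB \<Delta>C \<epsilon>C SC \<phi>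
  for \<Delta>B :: "'b::complex_algebra_1 \<Rightarrow> 'b \<otimes> 'b" and \<epsilon>B SB
    and \<Delta>C :: "'c::complex_algebra_1 \<Rightarrow> 'c \<otimes> 'c" and \<epsilon>C SC \<phi> +
  assumes phi_surj: "surj \<phi>"
    and kernel_adL: "\<phi> i = 0 \<Longrightarrow>
      tlift3 (\<lambda>x y z. (x * SB z) \<otimes> y) (coprodL \<Delta>B i) \<in> cspan {x \<otimes> y | x y. \<phi> y = 0}"
    and kernel_adR: "\<phi> i = 0 \<Longrightarrow>
      tlift3 (\<lambda>x y z. (x * SB z) \<otimes> y) (coprodR \<Delta>B i) \<in> cspan {x \<otimes> y | x y. \<phi> y = 0}"
    and kernel_coassociator: "\<phi> i = 0 \<Longrightarrow> coassociator \<Delta>B SB i = 0"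


section \<open>Central Hopf algebroids\<close>

text \<open>An element of a quotient \<open>V / J\<close> is represented by the corresponding coset, a subset of
  \<open>V\<close>. If the elements of the nonempty set \<open>A\<close> are all congruent modulo \<open>J\<close>, then \<open>mod_by J A\<close>
  is their common class; a well defined operation on a quotient is therefore given by applying
  the operation to all representatives and then \<open>mod_by\<close>.\<close>

definition mod_by :: "'v::ab_group_add set \<Rightarrow> 'v set \<Rightarrow> 'v set"
  where "mod_by J A = {y. \<exists>x\<in>A. y - x \<in> J}"

text \<open>The tensor product of maps \<open>F\<close>, \<open>G\<close> with values in quotients, applied to (all presentations
  of) all elements of \<open>X\<close>: the set of all representatives of the result.\<close>

definition tmap_set ::
    "('a::complex_vector \<Rightarrow> 'c::complex_vector set) \<Rightarrow>
     ('b::complex_vector \<Rightarrow> 'd::complex_vector set) \<Rightarrow> ('a \<otimes> 'b) set \<Rightarrow> ('c \<otimes> 'd) set"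
  where "tmap_set F G X =
    {\<Sum>i<n. u i \<otimes> v i | (n::nat) g k u v.
       (\<Sum>i<n. g i \<otimes> k i) \<in> X \<and> (\<forall>i<n. u i \<in> F (g i) \<and> v i \<in> G (k i))}"

text \<open>The subspaces by which \<open>H \<otimes> H\<close>, \<open>H \<otimes> H \<otimes> H\<close> and \<open>(H \<otimes> H) \<otimes> (H \<otimes> H)\<close> are divided to
  obtain \<open>H \<otimes>\<^sub>B H\<close>, \<open>H \<otimes>\<^sub>B H \<otimes>\<^sub>B H\<close> and \<open>(H \<otimes>\<^sub>B H) \<otimes> (H \<otimes>\<^sub>B H)\<close>, the bimodule structure
  being \<open>b \<triangleright> h \<triangleleft> b' = s(b) h t(b')\<close> with central \<open>s(b)\<close>, \<open>t(b')\<close>.\<close>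

definition bal2 :: "('b \<Rightarrow> 'h::complex_algebra_1) \<Rightarrow> ('b \<Rightarrow> 'h) \<Rightarrow> ('h \<otimes> 'h) set"
  where "bal2 s t = cspan {(t b * g) \<otimes> h - g \<otimes> (s b * h) | b g h. True}"

definition bal3 :: "('b \<Rightarrow> 'h::complex_algebra_1) \<Rightarrow> ('b \<Rightarrow> 'h) \<Rightarrow> ('h \<otimes> 'h \<otimes> 'h) set"
  where "bal3 s t = cspan
    ({(t b * g) \<otimes> h \<otimes> k - g \<otimes> (s b * h) \<otimes> k | b g h k. True} \<union>
     {g \<otimes> (t b * h) \<otimes> k - g \<otimes> h \<otimes> (s b * k) | b g h k. True})"

definition bal22 ::
    "('b \<Rightarrow> 'h::complex_algebra_1) \<Rightarrow> ('b \<Rightarrow> 'h) \<Rightarrow> (('h \<otimes> 'h) \<otimes> ('h \<otimes> 'h)) set"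
  where "bal22 s t = cspan
    ({x \<otimes> y | x y. x \<in> bal2 s t} \<union> {x \<otimes> y | x y. y \<in> bal2 s t})"

text \<open>\<open>conv \<Delta> f g h\<close> is \<open>f(h\<^sup>(\<^sup>1\<^sup>)) g(h\<^sup>(\<^sup>2\<^sup>))\<close> for a coproduct \<open>\<Delta>\<close> with values in \<open>H \<otimes>\<^sub>B H\<close>. It is
  meant for \<open>f\<close>, \<open>g\<close> such that \<open>x \<otimes> y \<mapsto> f(x) g(y)\<close> vanishes on \<open>bal2 s t\<close>, so that the value does
  not depend on the representative of \<open>\<Delta>(h)\<close>.\<close>

definition conv :: "('h::complex_vector \<Rightarrow> ('h \<otimes> 'h) set) \<Rightarrow> ('h \<Rightarrow> 'a::complex_algebra_1) \<Rightarrow>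
    ('h \<Rightarrow> 'a) \<Rightarrow> 'h \<Rightarrow> 'a"
  where "conv \<Delta> f g h = the_elem (tlift (\<lambda>x y. f x * g y) ` \<Delta> h)"

locale central_hopf_algebroid =
  fixes s t :: "'b::complex_algebra_1 \<Rightarrow> 'h::complex_algebra_1"
    and \<Delta> :: "'h \<Rightarrow> ('h \<otimes> 'h) set" and \<epsilon> :: "'h \<Rightarrow> 'b" and S :: "'h \<Rightarrow> 'h"
  assumes base_commute: "(b::'b) * b' = b' * b"
    and source_hom: "alg_hom s" and target_hom: "alg_hom t"
    and antipode_antihom: "alg_antihom S"
    and source_central: "s b * h = h * s b" and target_central: "t b * h = h * t b"
    and coproduct_coset: "\<exists>x. \<Delta> h = mod_by (bal2 s t) {x}"
    and coproduct_add: "\<Delta> (h + h') = mod_by (bal2 s t) {x + y | x y. x \<in> \<Delta> h \<and> y \<in> \<Delta> h'}"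
    and coproduct_scale: "\<Delta> (c *\<^sub>C h) = mod_by (bal2 s t) {c *\<^sub>C x | x. x \<in> \<Delta> h}"
    and coproduct_bimodule:
      "\<Delta> (s b * h * t b') = mod_by (bal2 s t) {(s b \<otimes> 1) * x * (1 \<otimes> t b') | x. x \<in> \<Delta> h}"
    and counit_bimodule: "\<epsilon> (s b * h * t b') = b * \<epsilon> h * b'"
    and coring_coassoc:
      "mod_by (bal3 s t) (tassoc ` tmap_set \<Delta> (\<lambda>h. {h}) (\<Delta> h)) =
       mod_by (bal3 s t) (tmap_set (\<lambda>h. {h}) \<Delta> (\<Delta> h))"
    and coring_counit_left: "conv \<Delta> (s \<circ> \<epsilon>) id h = h"
    and coring_counit_right: "conv \<Delta> id (t \<circ> \<epsilon>) h = h"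
    and coproduct_one: "\<Delta> 1 = mod_by (bal2 s t) {1}"
    and coproduct_mult: "\<Delta> (h * h') = mod_by (bal2 s t) {x * y | x y. x \<in> \<Delta> h \<and> y \<in> \<Delta> h'}"
    and counit_hom: "alg_hom \<epsilon>"
    and antipode_bimodule: "S (t b * h * s b') = t b' * S h * s b"
    and antipode_left: "conv \<Delta> S id h = t (\<epsilon> h)"
    and antipode_right: "conv \<Delta> id S h = s (\<epsilon> h)"


section \<open>Coherent Hopf 2-algebras\<close>

text \<open>The Hopf coquasigroup and the Hopf algebroid on \<open>H\<close> share the algebra structure of the
  type \<open>'h\<close>. Here \<open>\<Delta>H\<close> is the coproduct of the Hopf coquasigroup and \<open>\<Delta>\<close> that of the Hopf
  algebroid.\<close>

locale coherent_hopf_2_algebra =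
  B: hopf_coquasigroup \<Delta>B \<epsilon>B SB +
  H: hopf_coquasigroup \<Delta>H \<epsilon>H SH +
  central_hopf_algebroid s t \<Delta> \<epsilon> S
  for \<Delta>B :: "'b::complex_algebra_1 \<Rightarrow> 'b \<otimes> 'b" and \<epsilon>B SB
    and \<Delta>H :: "'h::complex_algebra_1 \<Rightarrow> 'h \<otimes> 'h" and \<epsilon>H SH
    and s t :: "'b \<Rightarrow> 'h" and \<Delta> \<epsilon> S +
  fixes \<alpha> :: "'h \<Rightarrow> 'b \<otimes> 'b \<otimes> 'b"
  assumes coassociator_hom: "alg_hom \<alpha>"
    and counit_hopf_hom: "hopf_coquasigroup_hom \<Delta>H \<epsilon>H \<Delta>B \<epsilon>B \<epsilon>"
    and source_hopf_hom: "hopf_coquasigroup_hom \<Delta>B \<epsilon>B \<Delta>H \<epsilon>H s"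
    and target_hopf_hom: "hopf_coquasigroup_hom \<Delta>B \<epsilon>B \<Delta>H \<epsilon>H t"
    and cocommutation:
      "mod_by (bal22 s t) (tmap_set \<Delta> \<Delta> {\<Delta>H h}) =
       mod_by (bal22 s t) ((tswap_mid \<circ> tmap \<Delta>H \<Delta>H) ` \<Delta> h)"
    and coassociator_target: "\<alpha> (t b) = coprodL \<Delta>B b"
    and coassociator_source: "\<alpha> (s b) = coprodR \<Delta>B b"
    and coassociator_natural:
      "conv \<Delta> (tmap s (tmap s s) \<circ> \<alpha>) (coprodL \<Delta>H) h =
       conv \<Delta> (coprodR \<Delta>H) (tmap t (tmap t t) \<circ> \<alpha>) h"
    and coassociator_cocycle:
      "conv \<Delta>
         (conv \<Delta> (tmap \<epsilon> \<alpha> \<circ> \<Delta>H) (tmap id (tassoc \<circ> tmap \<Delta>B id) \<circ> \<alpha>))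
         (tmap id tassoc \<circ> tassoc \<circ> tmap \<alpha> \<epsilon> \<circ> \<Delta>H) h =
       conv \<Delta> (tmap id (tmap id \<Delta>B) \<circ> \<alpha>) (tassoc \<circ> tmap \<Delta>B id \<circ> \<alpha>) h"

end

theory Submission
  imports Defs
begin

text \<open>
  A commutative \<open>B\<close> is determined by its points: for a commutative algebra \<open>A\<close>, the algebra
  maps \<open>B \<rightarrow> A\<close> form an inverse property loop \<open>G\<close> under convolution, and those vanishing on \<open>ker
  \<phi>\<close> form a subgroup \<open>N\<close>. The axioms of a quasi coassociative pair say that \<open>N\<close> lies in the
  nucleus, is normal, and contains all associators. A point of \<open>H = C \<otimes> B\<close> is a pair \<open>(n, g) \<in>
  N \<times> G\<close>, an arrow from \<open>n g\<close> (the restriction along \<open>s\<close>) to \<open>g\<close> (the restriction along \<open>t\<close>).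
  As \<open>n\<close> is recovered from \<open>n g\<close> and \<open>g\<close>, two algebra maps out of \<open>H\<close> into a commutative
  algebra agree as soon as they agree on \<open>s(B)\<close> and \<open>t(B)\<close>. Every axiom thereby reduces to an
  identity between words in the loop \<open>G\<close>. The tensor product \<open>H \<otimes>\<^sub>B H\<close> is identified with \<open>C \<otimes>
  C \<otimes> B\<close>, and convolution of algebra maps \<open>f\<close>, \<open>g\<close> with \<open>f \<circ> t = g \<circ> s\<close> is composition of
  arrows.
\<close>

section \<open>Linear maps and tensor products\<close>

lemma clinear_id [simp]: "clinear id" "clinear (\<lambda>x. x)"
  by (simp_all add: clinear_iff)

lemma clinear_compose: "clinear f \<Longrightarrow> clinear g \<Longrightarrow> clinear (g \<circ> f)"
  by (simp add: clinear_iff)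

lemma clinear_add: "clinear f \<Longrightarrow> f (x + y) = f x + f y"
  and clinear_scale: "clinear f \<Longrightarrow> f (c *\<^sub>C x) = c *\<^sub>C f x"
  by (simp_all add: clinear_iff)

lemma clinear_0: "clinear f \<Longrightarrow> f 0 = 0"
  by (metis clinear_iff add_cancel_right_right)

lemma clinear_diff: "clinear f \<Longrightarrow> f (x - y) = f x - f y"
  by (metis clinear_iff diff_add_cancel eq_diff_eq)

lemma clinear_sum: "clinear f \<Longrightarrow> f (\<Sum>i\<in>A. u i) = (\<Sum>i\<in>A. f (u i))"
  by (induction A rule: infinite_finite_induct) (simp_all add: clinear_0 clinear_iff)

lemma tensor_zero [simp]: "0 \<otimes> b = 0" "a \<otimes> 0 = 0"
  using tensor_add_left[of 0 0 b] tensor_add_right[of a 0 0] by simp_all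

lemma clinear_mult_left: "clinear F \<Longrightarrow> clinear (\<lambda>x. w * F x)"
  and clinear_mult_right: "clinear F \<Longrightarrow> clinear (\<lambda>x. F x * w)"
  for w :: "'a::complex_algebra_1"
  by (simp_all add: clinear_iff distrib_left distrib_right mult_scaleC_left mult_scaleC_right)

lemma tensor_diff_left: "(a - a') \<otimes> b = a \<otimes> b - a' \<otimes> b"
  by (metis add_diff_cancel diff_add_cancel tensor_add_left)

lemma tensor_diff_right: "a \<otimes> (b - b') = a \<otimes> b - a \<otimes> b'"
  by (metis add_diff_cancel diff_add_cancel tensor_add_right)

lemma cbilinearI:
  assumes "\<And>a a' b. f (a + a') b = f a b + f a' b" "\<And>a b b'. f a (b + b') = f a b + f a b'"
    and "\<And>c a b. f (c *\<^sub>C a) b = c *\<^sub>C f a b" "\<And>c a b. f a (c *\<^sub>C b) = c *\<^sub>C f a b"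
  shows "cbilinear f"
  using assms by (simp add: cbilinear_def clinear_iff)

lemma cbilinear_tensor:
  assumes "clinear f" "clinear g"
  shows "cbilinear (\<lambda>a b. f a \<otimes> g b)"
  using assms by (intro cbilinearI) (simp_all add: clinear_iff tensor_add_left tensor_add_right
      tensor_scale_left tensor_scale_right)

lemma cbilinear_mult:
  fixes f :: "'a::complex_vector \<Rightarrow> 'd::complex_algebra_1"
  assumes "clinear f" "clinear g"
  shows "cbilinear (\<lambda>a b. f a * g b)"
  using assms by (intro cbilinearI) (simp_all add: clinear_iff distrib_left distrib_right
      mult_scaleC_left mult_scaleC_right)

lemma tmap_tensor: "clinear f \<Longrightarrow> clinear g \<Longrightarrow> tmap f g (a \<otimes> b) = f a \<otimes> g b"
  by (simp add: tmap_def tlift_tensor cbilinear_tensor)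

lemma clinear_tmap: "clinear f \<Longrightarrow> clinear g \<Longrightarrow> clinear (tmap f g)"
  by (simp add: tmap_def clinear_tlift cbilinear_tensor)

lemma tmap_tmap:
  assumes "clinear f" "clinear g" "clinear f'" "clinear g'"
  shows "tmap f' g' (tmap f g x) = tmap (\<lambda>a. f' (f a)) (\<lambda>b. g' (g b)) x"
proof (induction x rule: tensor_induct)
  case (tensor a b)
  have "clinear (\<lambda>a. f' (f a))" "clinear (\<lambda>b. g' (g b))"
    using assms by (simp_all add: clinear_iff)
  then show ?case by (simp add: tmap_tensor assms)
next
  case (add x y)
  have "clinear (\<lambda>a. f' (f a))" "clinear (\<lambda>b. g' (g b))"
    using assms by (simp_all add: clinear_iff)
  from clinear_tmap[OF this] clinear_tmap[OF assms(1,2)] clinear_tmap[OF assms(3,4)] add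
  show ?case by (simp add: clinear_iff)
qed

lemma tmap_comp_tmap:
  assumes "clinear f" "clinear g" "clinear f'" "clinear g'"
  shows "tmap f' g' \<circ> (tmap f g \<circ> k) = tmap (f' \<circ> f) (g' \<circ> g) \<circ> k"
  by (simp add: fun_eq_iff tmap_tmap[OF assms] o_def)

text \<open>On a map that is not bilinear \<open>tlift\<close> is an unspecified value, so
  \<open>tassoc\<close> can only be evaluated once its inner and its outer lift are both known to be
  legitimate.\<close>

lemma cbilinear_tassoc:
  "cbilinear (\<lambda>x (c::'c::complex_vector).
     tlift (\<lambda>(a::'a::complex_vector) (b::'b::complex_vector). a \<otimes> (b \<otimes> c)) x)"
proof -
  have bl: "cbilinear (\<lambda>(a::'a) (b::'b). a \<otimes> (b \<otimes> c))" for c :: 'c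
    by (intro cbilinearI) (simp_all add: tensor_add_left tensor_add_right
      tensor_scale_left tensor_scale_right)
  define M where "M c = tlift (\<lambda>(a::'a) (b::'b). a \<otimes> (b \<otimes> c))" for c :: 'c
  have l: "M c (a \<otimes> b) = a \<otimes> (b \<otimes> c)" "M c (x + y) = M c x + M c y"
    "M c (k *\<^sub>C x) = k *\<^sub>C M c x" for a b c k x y
    using tlift_tensor[OF bl] clinear_tlift[OF bl, of c]
    by (simp_all add: clinear_iff M_def)
  show ?thesis
    unfolding M_def[symmetric]
  proof (rule cbilinearI)
    fix x and c d :: 'c and k
    show "M (c + d) x = M c x + M d x"
      by (induction x rule: tensor_induct) (simp_all add: l tensor_add_right)
    show "M (k *\<^sub>C c) x = k *\<^sub>C M c x"
      by (induction x rule: tensor_induct)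
        (simp_all add: l tensor_scale_right cvec.scale_right_distrib)
  qed (simp_all add: l)
qed

lemma tassoc_tensor [simp]: "tassoc ((a \<otimes> b) \<otimes> c) = a \<otimes> (b \<otimes> c)"
proof -
  have bl: "cbilinear (\<lambda>a b. a \<otimes> (b \<otimes> c))" for c :: 'c
    by (intro cbilinearI) (simp_all add: tensor_add_left tensor_add_right
      tensor_scale_left tensor_scale_right)
  show ?thesis by (simp add: tassoc_def tlift_tensor[OF cbilinear_tassoc] tlift_tensor[OF bl])
qed

lemma clinear_tassoc: "clinear tassoc"
  by (simp add: tassoc_def clinear_tlift[OF cbilinear_tassoc])

lemmas tassoc_add [simp] = clinear_add[OF clinear_tassoc]

lemma tensor3_induct [case_names tensor add]:
  assumes "\<And>a b c. P (a \<otimes> b \<otimes> c)" and add: "\<And>x y. P x \<Longrightarrow> P y \<Longrightarrow> P (x + y)"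
  shows "P t"
proof (induction t rule: tensor_induct)
  case (tensor a x)
  show ?case
    by (induction x rule: tensor_induct) (simp_all add: assms tensor_add_right)
qed (rule add)

lemma tensor22_induct [case_names tensor add]:
  assumes pure: "\<And>a b x. P ((a \<otimes> b) \<otimes> x)" and add: "\<And>x y. P x \<Longrightarrow> P y \<Longrightarrow> P (x + y)"
  shows "P t"
proof (induction t rule: tensor_induct)
  case (tensor x c)
  show ?case
    by (induction x rule: tensor_induct) (simp_all add: assms tensor_add_left)
qed (rule add)

lemma tlift_mult_left:
  fixes w :: "'d::complex_algebra_1"
  assumes "cbilinear f"
  shows "tlift (\<lambda>a b. w * f a b) X = w * tlift f X"
proof -
  have "cbilinear (\<lambda>a b. w * f a b)"
    using assms by (simp add: cbilinear_def clinear_iff distrib_left mult_scaleC_right)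
  note l = tlift_tensor[OF this] clinear_tlift[OF this, unfolded clinear_iff]
    tlift_tensor[OF assms] clinear_tlift[OF assms, unfolded clinear_iff]
  show ?thesis by (induction X rule: tensor_induct) (simp_all add: l distrib_left)
qed

lemma tlift_mult_right:
  fixes w :: "'d::complex_algebra_1"
  assumes "cbilinear f"
  shows "tlift (\<lambda>a b. f a b * w) X = tlift f X * w"
proof -
  have "cbilinear (\<lambda>a b. f a b * w)"
    using assms by (simp add: cbilinear_def clinear_iff distrib_right mult_scaleC_left)
  note l = tlift_tensor[OF this] clinear_tlift[OF this, unfolded clinear_iff]
    tlift_tensor[OF assms] clinear_tlift[OF assms, unfolded clinear_iff]
  show ?thesis by (induction X rule: tensor_induct) (simp_all add: l distrib_right)
qed

text \<open>Bilinearity of \<open>f\<close> comes for free: it is inherited from the linear map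
  \<open>F\<close> through the bilinearity of the tensor symbol. Sweedler expressions are evaluated
  below by exhibiting such an \<open>F\<close>.\<close>

lemma tlift_unique:
  assumes "clinear F" "\<And>a b. F (a \<otimes> b) = f a b"
  shows "tlift f = F"
proof -
  have "f = (\<lambda>a b. F (a \<otimes> b))" using assms(2) by auto
  then have bl: "cbilinear f"
    using assms(1) by (simp add: cbilinear_def clinear_iff tensor_add_left tensor_add_right
      tensor_scale_left tensor_scale_right)
  show ?thesis
    by (rule clinear_tensor_eqI[OF clinear_tlift[OF bl] assms(1)])
      (simp add: tlift_tensor[OF bl] assms(2))
qed

lemma tlift3_unique:
  assumes "clinear F" "\<And>a b c. F (a \<otimes> b \<otimes> c) = f a b c"
  shows "tlift3 f = F"
  unfolding tlift3_def
proof (rule tlift_unique[OF assms(1)])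
  fix a x
  have "tlift (f a) = (\<lambda>x. F (a \<otimes> x))"
    by (rule tlift_unique)
      (use assms in \<open>simp_all add: clinear_iff tensor_add_right tensor_scale_right\<close>)
  then show "F (a \<otimes> x) = tlift (f a) x" by simp
qed

section \<open>Points with values in commutative algebras\<close>

text \<open>A predicate on types rather than a type class, because commutativity of \<open>B\<close>
  is a hypothesis of the theorem and that of \<open>C\<close> has to be derived.\<close>

definition comm_alg :: "'a::complex_algebra_1 itself \<Rightarrow> bool"
  where "comm_alg _ \<longleftrightarrow> (\<forall>x y::'a. x * y = y * x)"

lemma comm_algD: "comm_alg TYPE('a::complex_algebra_1) \<Longrightarrow> x * y = y * (x::'a)"
  by (simp add: comm_alg_def)

lemma comm_alg_complex [simp]: "comm_alg TYPE(complex)"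
  by (simp add: comm_alg_def)

lemma comm_alg_tensor [simp]:
  assumes "comm_alg TYPE('a::complex_algebra_1)" "comm_alg TYPE('b::complex_algebra_1)"
  shows "comm_alg TYPE('a \<otimes> 'b)"
  unfolding comm_alg_def
proof (intro allI)
  fix x y :: "'a \<otimes> 'b"
  show "x * y = y * x"
  proof (induction x rule: tensor_induct)
    case (tensor a b)
    show ?case
      by (induction y rule: tensor_induct)
        (simp_all add: times_tensor_tensor distrib_left distrib_right
          comm_algD[OF assms(1), of a] comm_algD[OF assms(2), of b])
  qed (simp add: distrib_left distrib_right)
qed

section \<open>Algebra maps, and the tensor product as coproduct of commutative algebras\<close>

named_theorems ahom

lemma alg_hom_linear [simp]: "alg_hom f \<Longrightarrow> clinear f"
  by (simp add: alg_hom_def)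

lemma alg_hom_mult: "alg_hom f \<Longrightarrow> f (x * y) = f x * f y"
  and alg_hom_one: "alg_hom f \<Longrightarrow> f 1 = 1"
  and alg_hom_add: "alg_hom f \<Longrightarrow> f (x + y) = f x + f y"
  and alg_hom_scale: "alg_hom f \<Longrightarrow> f (c *\<^sub>C x) = c *\<^sub>C f x"
  by (simp_all add: alg_hom_def clinear_iff)

lemma alg_homI:
  "clinear f \<Longrightarrow> f 1 = 1 \<Longrightarrow> (\<And>x y. f (x * y) = f x * f y) \<Longrightarrow> alg_hom f"
  by (simp add: alg_hom_def)

lemma alg_hom_id [ahom, simp]: "alg_hom id" "alg_hom (\<lambda>x. x)"
  by (simp_all add: alg_hom_def)

lemma alg_hom_comp [ahom]: "alg_hom g \<Longrightarrow> alg_hom f \<Longrightarrow> alg_hom (g \<circ> f)"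
  by (simp add: alg_hom_def clinear_compose)

text \<open>For commutative algebras \<open>tinl\<close> and \<open>tinr\<close> are the injections
  of the coproduct. They form the universal pair of points: an identity proved for them holds for
  every pair, by postcomposition with \<open>copair f g\<close>.\<close>

definition tinl :: "'a::complex_algebra_1 \<Rightarrow> 'a \<otimes> 'b::complex_algebra_1"
  where "tinl x = x \<otimes> 1"

definition tinr :: "'b::complex_algebra_1 \<Rightarrow> 'a::complex_algebra_1 \<otimes> 'b"
  where "tinr y = 1 \<otimes> y"

lemma alg_hom_tinl [ahom, simp]: "alg_hom tinl"
  by (simp add: alg_hom_def clinear_iff tinl_def tensor_add_left tensor_scale_left
      times_tensor_tensor one_tensor_def)

lemma alg_hom_tinr [ahom, simp]: "alg_hom tinr"
  by (simp add: alg_hom_def clinear_iff tinr_def tensor_add_right tensor_scale_right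
      times_tensor_tensor one_tensor_def)

lemma tinl_mult_tinr [simp]: "tinl a * tinr b = a \<otimes> b"
  by (simp add: tinl_def tinr_def times_tensor_tensor)

lemma alg_hom_tensorI:
  assumes "clinear F" "F (1 \<otimes> 1) = 1"
    and "\<And>a b a' b'. F ((a * a') \<otimes> (b * b')) = F (a \<otimes> b) * F (a' \<otimes> b')"
  shows "alg_hom F"
proof (rule alg_homI)
  show "F (x * y) = F x * F y" for x y
  proof (induction x rule: tensor_induct)
    case (tensor a b)
    show ?case
      by (induction y rule: tensor_induct) (use assms in
        \<open>simp_all add: times_tensor_tensor distrib_left clinear_iff\<close>)
  qed (use assms in \<open>simp add: distrib_right clinear_iff\<close>)
qed (use assms in \<open>simp_all add: one_tensor_def\<close>)

lemma alg_hom_tensor_eqI: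
  assumes "alg_hom F" "alg_hom G" "F \<circ> tinl = G \<circ> tinl" "F \<circ> tinr = G \<circ> tinr"
  shows "F = G"
proof (rule clinear_tensor_eqI)
  show "F (a \<otimes> b) = G (a \<otimes> b)" for a b
    using assms(3,4) alg_hom_mult[OF assms(1)] alg_hom_mult[OF assms(2)]
    by (metis comp_apply tinl_mult_tinr)
qed (use assms in simp_all)

text \<open>The map that a pair of points induces on the coproduct. Only linearity is asked of the
  two arguments, so that an antipode may occur before it is known to be multiplicative.\<close>

definition copair :: "('a::complex_vector \<Rightarrow> 'd::complex_algebra_1) \<Rightarrow>
    ('b::complex_vector \<Rightarrow> 'd) \<Rightarrow> 'a \<otimes> 'b \<Rightarrow> 'd"
  where "copair f g = tlift (\<lambda>a b. f a * g b)"

lemma copair_tensor: "clinear f \<Longrightarrow> clinear g \<Longrightarrow> copair f g (a \<otimes> b) = f a * g b"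
  by (simp add: copair_def tlift_tensor cbilinear_mult)

lemma clinear_copair [simp]: "clinear f \<Longrightarrow> clinear g \<Longrightarrow> clinear (copair f g)"
  by (simp add: copair_def clinear_tlift cbilinear_mult)

lemma alg_hom_copair [ahom]:
  fixes f :: "'a::complex_algebra_1 \<Rightarrow> 'd::complex_algebra_1"
  assumes "comm_alg TYPE('d)" "alg_hom f" "alg_hom g"
  shows "alg_hom (copair f g)"
proof (rule alg_hom_tensorI)
  fix a a' b b'
  have "f a * f a' * (g b * g b') = f a * g b * (f a' * g b')"
    by (metis comm_algD[OF assms(1)] mult.assoc)
  then show "copair f g ((a * a') \<otimes> (b * b')) = copair f g (a \<otimes> b) * copair f g (a' \<otimes> b')"
    using assms by (simp add: copair_tensor alg_hom_mult)
qed (use assms in \<open>simp_all add: copair_tensor alg_hom_one\<close>)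

lemma copair_tinl [simp]: "alg_hom f \<Longrightarrow> alg_hom g \<Longrightarrow> copair f g \<circ> tinl = f"
  by (simp add: fun_eq_iff tinl_def copair_tensor alg_hom_one)

lemma copair_tinr [simp]: "alg_hom f \<Longrightarrow> alg_hom g \<Longrightarrow> copair f g \<circ> tinr = g"
  by (simp add: fun_eq_iff tinr_def copair_tensor alg_hom_one)

lemma copair_tinl_comp [simp]:
    "alg_hom f \<Longrightarrow> alg_hom g \<Longrightarrow> copair f g \<circ> (tinl \<circ> k) = f \<circ> k"
  and copair_tinr_comp [simp]:
    "alg_hom f \<Longrightarrow> alg_hom g \<Longrightarrow> copair f g \<circ> (tinr \<circ> l) = g \<circ> l"
  by (simp_all flip: comp_assoc)

lemma comp_copair:
  assumes "alg_hom F" "clinear f" "clinear g"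
  shows "F \<circ> copair f g = copair (F \<circ> f) (F \<circ> g)"
  by (rule clinear_tensor_eqI)
    (use assms in \<open>simp_all add: copair_tensor alg_hom_mult clinear_compose\<close>)

lemma copair_comp_tmap:
  assumes "clinear f" "clinear g" "clinear f'" "clinear g'"
  shows "copair f g (tmap f' g' x) = copair (f \<circ> f') (g \<circ> g') x"
proof -
  have "copair f g \<circ> tmap f' g' = copair (f \<circ> f') (g \<circ> g')"
    by (rule clinear_tensor_eqI)
      (use assms in \<open>simp_all add: copair_tensor tmap_tensor clinear_compose clinear_tmap\<close>)
  then show ?thesis by (simp add: fun_eq_iff)
qed

lemma copair_eta: "alg_hom F \<Longrightarrow> copair (F \<circ> tinl) (F \<circ> tinr) = F"
  by (rule clinear_tensor_eqI) (simp_all add: copair_tensor clinear_compose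
      flip: alg_hom_mult)

lemma tmap_eq_copair:
  assumes "clinear f" "clinear g"
  shows "tmap f g = copair (tinl \<circ> f) (tinr \<circ> g)"
  by (rule clinear_tensor_eqI)
    (use assms in \<open>simp_all add: tmap_tensor copair_tensor clinear_compose clinear_tmap\<close>)

lemma alg_hom_tmap [ahom]:
  assumes "alg_hom f" "alg_hom g"
  shows "alg_hom (tmap f g)"
  by (rule alg_hom_tensorI)
    (use assms in \<open>simp_all add: clinear_tmap tmap_tensor alg_hom_mult alg_hom_one
      times_tensor_tensor one_tensor_def\<close>)

lemma alg_hom_tassoc [ahom, simp]: "alg_hom tassoc"
proof (rule alg_homI)
  show "tassoc (x * y) = tassoc x * tassoc y" for x y :: "('a \<otimes> 'b) \<otimes> 'c"
  proof (induction x rule: tensor22_induct)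
    case (tensor a b c)
    show ?case
      by (induction y rule: tensor22_induct) (simp_all add: times_tensor_tensor distrib_left)
  qed (simp add: distrib_right)
qed (simp_all add: clinear_tassoc one_tensor_def)

lemma tmap_tinl:
  "alg_hom f \<Longrightarrow> alg_hom g \<Longrightarrow> tmap f g \<circ> tinl = tinl \<circ> f"
  by (simp add: fun_eq_iff tinl_def tmap_tensor alg_hom_one)

lemma tmap_tinr:
  "alg_hom f \<Longrightarrow> alg_hom g \<Longrightarrow> tmap f g \<circ> tinr = tinr \<circ> g"
  by (simp add: fun_eq_iff tinr_def tmap_tensor alg_hom_one)

lemma tmap_tinl_comp: "alg_hom f \<Longrightarrow> alg_hom g \<Longrightarrow> tmap f g \<circ> (tinl \<circ> k) = tinl \<circ> (f \<circ> k)"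
  by (simp add: tmap_tinl flip: comp_assoc)

lemma tmap_tinr_comp: "alg_hom f \<Longrightarrow> alg_hom g \<Longrightarrow> tmap f g \<circ> (tinr \<circ> k) = tinr \<circ> (g \<circ> k)"
  by (simp add: tmap_tinr flip: comp_assoc)

lemma tassoc_comp:
  "tassoc \<circ> (tinl \<circ> tinl) = tinl" "tassoc \<circ> (tinl \<circ> (tinl \<circ> f)) = tinl \<circ> f"
  "tassoc \<circ> (tinl \<circ> tinr) = tinr \<circ> tinl" "tassoc \<circ> (tinl \<circ> (tinr \<circ> g)) = tinr \<circ> (tinl \<circ> g)"
  "tassoc \<circ> tinr = tinr \<circ> tinr" "tassoc \<circ> (tinr \<circ> h) = tinr \<circ> (tinr \<circ> h)"
  by (simp_all add: fun_eq_iff tinl_def tinr_def one_tensor_def)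

section \<open>Convolution as the product of points\<close>

definition cprod :: "('h::complex_vector \<Rightarrow> 'h \<otimes> 'h) \<Rightarrow> ('h \<Rightarrow> 'a::complex_algebra_1) \<Rightarrow>
    ('h \<Rightarrow> 'a) \<Rightarrow> 'h \<Rightarrow> 'a"
  where "cprod \<Delta> f g = copair f g \<circ> \<Delta>"

lemma clinear_cprod [simp]:
  "clinear \<Delta> \<Longrightarrow> clinear f \<Longrightarrow> clinear g \<Longrightarrow> clinear (cprod \<Delta> f g)"
  by (simp add: cprod_def clinear_compose)

lemma alg_hom_cprod [ahom]:
  fixes f :: "'h::complex_algebra_1 \<Rightarrow> 'a::complex_algebra_1"
  shows "comm_alg TYPE('a) \<Longrightarrow> alg_hom \<Delta> \<Longrightarrow> alg_hom f \<Longrightarrow> alg_hom g \<Longrightarrow> alg_hom (cprod \<Delta> f g)"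
  by (simp add: cprod_def ahom)

text \<open>Naturality in the target algebra: postcomposition with an algebra map is a homomorphism
  of the loops of points.\<close>

lemma comp_cprod:
  "alg_hom F \<Longrightarrow> clinear f \<Longrightarrow> clinear g \<Longrightarrow> F \<circ> cprod \<Delta> f g = cprod \<Delta> (F \<circ> f) (F \<circ> g)"
  by (simp add: cprod_def comp_copair flip: comp_assoc)

text \<open>The Yoneda form of a coproduct: it is the product of the two universal points. This
  turns every composite with a coproduct into a loop word.\<close>

lemma comp_coproduct: "alg_hom F \<Longrightarrow> F \<circ> \<Delta> = cprod \<Delta> (F \<circ> tinl) (F \<circ> tinr)"
  by (simp add: cprod_def copair_eta)

lemma cprod_hom:
  assumes "\<And>x. \<Delta>' (\<phi> x) = tmap \<phi> \<phi> (\<Delta> x)" "clinear \<phi>" "clinear f" "clinear g"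
  shows "cprod \<Delta>' f g \<circ> \<phi> = cprod \<Delta> (f \<circ> \<phi>) (g \<circ> \<phi>)"
  by (simp add: fun_eq_iff cprod_def copair_comp_tmap assms)

lemma tmap_coproduct:
  "clinear f \<Longrightarrow> clinear g \<Longrightarrow> tmap f g \<circ> \<Delta> = cprod \<Delta> (tinl \<circ> f) (tinr \<circ> g)"
  by (simp add: tmap_eq_copair cprod_def)

lemma copair_tassoc:
  assumes "clinear f" "clinear g" "clinear k"
  shows "copair f (copair g k) (tassoc w) = copair (copair f g) k w"
  using assms by (induction w rule: tensor22_induct)
    (simp_all add: copair_tensor mult.assoc clinear_add[OF clinear_copair])

text \<open>The two bracketings of a triple product are governed by the two iterated coproducts, so
  a failure of coassociativity is a failure of associativity among points.\<close>

lemma cprod_cprod_left: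
  assumes "clinear f" "clinear g" "clinear k" "clinear \<Delta>"
  shows "cprod \<Delta> (cprod \<Delta> f g) k h = copair f (copair g k) (coprodL \<Delta> h)"
  using assms by (simp add: cprod_def coprodL_def copair_tassoc copair_comp_tmap)

lemma cprod_cprod_right:
  assumes "clinear f" "clinear g" "clinear k" "clinear \<Delta>"
  shows "cprod \<Delta> f (cprod \<Delta> g k) h = copair f (copair g k) (coprodR \<Delta> h)"
  using assms by (simp add: cprod_def coprodR_def copair_comp_tmap clinear_compose)

lemma tlift3_eq_copair:
  assumes "clinear f" "clinear g" "clinear k" "\<And>a b c. F a b c = f a * (g b * k c)"
  shows "tlift3 F = copair f (copair g k)"
  by (rule tlift3_unique) (use assms in \<open>simp_all add: copair_tensor\<close>)

lemma copair3_eta: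
  assumes "alg_hom F"
  shows "copair (F \<circ> tinl) (copair (F \<circ> tinr \<circ> tinl) (F \<circ> tinr \<circ> tinr)) = F"
  using assms by (simp add: copair_eta ahom)

lemma comp_coprodL:
  assumes "alg_hom F" "clinear \<Delta>"
  shows "F \<circ> coprodL \<Delta> =
    cprod \<Delta> (cprod \<Delta> (F \<circ> tinl) (F \<circ> tinr \<circ> tinl)) (F \<circ> tinr \<circ> tinr)"
  using assms by (simp add: fun_eq_iff cprod_cprod_left clinear_compose copair3_eta)

lemma comp_coprodR:
  assumes "alg_hom F" "clinear \<Delta>"
  shows "F \<circ> coprodR \<Delta> =
    cprod \<Delta> (F \<circ> tinl) (cprod \<Delta> (F \<circ> tinr \<circ> tinl) (F \<circ> tinr \<circ> tinr))"
  using assms by (simp add: fun_eq_iff cprod_cprod_right clinear_compose copair3_eta)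

lemma coprodL_eq:
  "clinear \<Delta> \<Longrightarrow> coprodL \<Delta> = cprod \<Delta> (cprod \<Delta> tinl (tinr \<circ> tinl)) (tinr \<circ> tinr)"
  using comp_coprodL[of id \<Delta>] by simp

lemma coprodR_eq:
  "clinear \<Delta> \<Longrightarrow> coprodR \<Delta> = cprod \<Delta> tinl (cprod \<Delta> (tinr \<circ> tinl) (tinr \<circ> tinr))"
  using comp_coprodR[of id \<Delta>] by simp

section \<open>The inverse property loop of points\<close>

context counital_bialgebra
begin

lemma coproduct_linear [simp]: "clinear \<Delta>"
  using coproduct_hom by simp

text \<open>The neutral element of the loop of points, for every target algebra at once.\<close>

definition unit_point :: "'h \<Rightarrow> 'a::complex_algebra_1"
  where "unit_point h = \<epsilon> h *\<^sub>C 1"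

lemma alg_hom_unit_point [ahom, simp]: "alg_hom unit_point"
proof (rule alg_homI)
  show "clinear unit_point"
    using counit_hom by (simp add: clinear_iff unit_point_def alg_hom_add alg_hom_scale
        scaleC_add_left scaleC_scaleC scaleC_complex_def)
qed (use counit_hom in \<open>simp_all add: unit_point_def alg_hom_one alg_hom_mult scaleC_one
    mult_scaleC_left mult_scaleC_right scaleC_scaleC\<close>)

lemma comp_unit_point: "alg_hom F \<Longrightarrow> F \<circ> unit_point = unit_point"
  by (simp add: fun_eq_iff unit_point_def alg_hom_scale alg_hom_one)

lemma unit_point_eq_counit: "unit_point = \<epsilon>"
  by (simp add: fun_eq_iff unit_point_def scaleC_complex_def)

lemma cprod_unit_left [simp]:
  assumes "clinear f"
  shows "cprod \<Delta> unit_point f = f"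
proof
  fix h
  have "cbilinear (\<lambda>x y::'h. \<epsilon> x *\<^sub>C y)"
    using counit_hom by (intro cbilinearI) (simp_all add: alg_hom_add alg_hom_scale
        scaleC_add_left scaleC_add_right scaleC_scaleC scaleC_complex_def mult.commute)
  note l = tlift_tensor[OF this] clinear_add[OF clinear_tlift[OF this]]
  have "copair unit_point f x = f (tlift (\<lambda>x y. \<epsilon> x *\<^sub>C y) x)" for x
    using assms by (induction x rule: tensor_induct)
      (simp_all add: l copair_tensor clinear_add[of f] clinear_scale[of f]
        clinear_add[of "copair unit_point f"] unit_point_def mult_scaleC_left)
  then show "cprod \<Delta> unit_point f h = f h"
    by (simp add: cprod_def counit_left)
qed

lemma cprod_unit_right [simp]:
  assumes "clinear f"
  shows "cprod \<Delta> f unit_point = f"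
proof
  fix h
  have "cbilinear (\<lambda>x y. \<epsilon> y *\<^sub>C (x::'h))"
    using counit_hom by (intro cbilinearI) (simp_all add: alg_hom_add alg_hom_scale
        scaleC_add_left scaleC_add_right scaleC_scaleC scaleC_complex_def mult.commute)
  note l = tlift_tensor[OF this] clinear_add[OF clinear_tlift[OF this]]
  have "copair f unit_point x = f (tlift (\<lambda>x y. \<epsilon> y *\<^sub>C x) x)" for x
    using assms by (induction x rule: tensor_induct)
      (simp_all add: l copair_tensor clinear_add[of f] clinear_scale[of f]
        clinear_add[of "copair f unit_point"] unit_point_def mult_scaleC_right)
  then show "cprod \<Delta> f unit_point h = f h"
    by (simp add: cprod_def counit_right)
qed

text \<open>This and the next three lemmas read the Sweedler form of the antipode axioms as words in
  the universal points. \<open>T\<close> is an arbitrary linear map, so that they serve both a given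
  antipode and a candidate for one.\<close>

lemma tlift3_coprodR1:
  "tlift3 (\<lambda>x y z. (T x * y) \<otimes> z) (coprodR \<Delta> h) =
    cprod \<Delta> (tinl \<circ> T) (cprod \<Delta> tinl tinr) h" if "clinear T"
  using that by (subst tlift3_eq_copair[where f="tinl \<circ> T" and g=tinl and k=tinr])
    (simp_all add: clinear_compose cprod_cprod_right tinl_def tinr_def times_tensor_tensor)

lemma tlift3_coprodR2:
  "tlift3 (\<lambda>x y z. (x * T y) \<otimes> z) (coprodR \<Delta> h) =
    cprod \<Delta> tinl (cprod \<Delta> (tinl \<circ> T) tinr) h" if "clinear T"
  using that by (subst tlift3_eq_copair[where f=tinl and g="tinl \<circ> T" and k=tinr])
    (simp_all add: clinear_compose cprod_cprod_right tinl_def tinr_def times_tensor_tensor)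

lemma tlift3_coprodL1:
  "tlift3 (\<lambda>x y z. x \<otimes> (T y * z)) (coprodL \<Delta> h) =
    cprod \<Delta> (cprod \<Delta> tinl (tinr \<circ> T)) tinr h" if "clinear T"
  using that by (subst tlift3_eq_copair[where f=tinl and g="tinr \<circ> T" and k=tinr])
    (simp_all add: clinear_compose cprod_cprod_left tinl_def tinr_def times_tensor_tensor)

lemma tlift3_coprodL2:
  "tlift3 (\<lambda>x y z. x \<otimes> (y * T z)) (coprodL \<Delta> h) =
    cprod \<Delta> (cprod \<Delta> tinl tinr) (tinr \<circ> T) h" if "clinear T"
  using that by (subst tlift3_eq_copair[where f=tinl and g=tinr and k="tinr \<circ> T"])
    (simp_all add: clinear_compose cprod_cprod_left tinl_def tinr_def times_tensor_tensor)

text \<open>The antipode axioms are the inverse property for the universal pair of points, so an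
  antipode can be recognised by loop identities.\<close>

lemma hopf_coquasigroupI:
  assumes "clinear T"
    and "cprod \<Delta> (tinl \<circ> T) (cprod \<Delta> tinl tinr) = tinr"
    and "cprod \<Delta> tinl (cprod \<Delta> (tinl \<circ> T) tinr) = tinr"
    and "cprod \<Delta> (cprod \<Delta> tinl (tinr \<circ> T)) tinr = tinl"
    and "cprod \<Delta> (cprod \<Delta> tinl tinr) (tinr \<circ> T) = tinl"
  shows "hopf_coquasigroup \<Delta> \<epsilon> T"
  by (intro hopf_coquasigroup.intro hopf_coquasigroup_axioms.intro counital_bialgebra_axioms)
    (simp_all add: assms tlift3_coprodR1 tlift3_coprodR2 tlift3_coprodL1 tlift3_coprodL2,
     simp_all add: tinl_def tinr_def)

end

section \<open>Hopf algebras as Hopf coquasigroups\<close>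

context hopf_algebra
begin

lemma cprod_assoc:
  assumes "clinear f" "clinear g" "clinear k"
  shows "cprod \<Delta> (cprod \<Delta> f g) k = cprod \<Delta> f (cprod \<Delta> g k)"
  using assms by (simp add: fun_eq_iff cprod_cprod_left cprod_cprod_right coassoc)

lemma antipode_unit:
  assumes "alg_hom f"
  shows "cprod \<Delta> (f \<circ> S) f = unit_point" "cprod \<Delta> f (f \<circ> S) = unit_point"
proof -
  have "cprod \<Delta> S id = unit_point" "cprod \<Delta> id S = unit_point"
    by (simp_all add: fun_eq_iff cprod_def copair_def unit_point_def antipode_left antipode_right)
  then have "f \<circ> cprod \<Delta> S id = unit_point" "f \<circ> cprod \<Delta> id S = unit_point"
    using assms by (simp_all add: comp_unit_point)
  then show "cprod \<Delta> (f \<circ> S) f = unit_point" "cprod \<Delta> f (f \<circ> S) = unit_point"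
    using assms antipode_linear by (simp_all add: comp_cprod)
qed

lemma hopf_coquasigroup: "hopf_coquasigroup \<Delta> \<epsilon> S"
  \<comment> \<open>Bracketing to the right settles the two axioms on the left iterated coproduct;
    bracketing to the left settles the other two.\<close>
  by (rule hopf_coquasigroupI)
    (simp_all add: antipode_linear clinear_compose antipode_unit cprod_assoc,
     simp_all add: antipode_linear clinear_compose antipode_unit flip: cprod_assoc)

end

section \<open>The inverse property for arbitrary points\<close>

context hopf_coquasigroup
begin

declare antipode_linear [simp]

text \<open>The axioms give the four identities for \<open>tinl\<close> and \<open>tinr\<close>.
  Postcomposition with \<open>copair f g\<close> or \<open>copair g f\<close>, algebra maps because
  the target is commutative, carries them to \<open>f\<close> and \<open>g\<close>.\<close>

lemma point_inverse:
  fixes f g :: "'h \<Rightarrow> 'a::complex_algebra_1"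
  assumes "comm_alg TYPE('a)" and f: "alg_hom f" and g: "alg_hom g"
  shows inv_mult_cancel: "cprod \<Delta> (f \<circ> S) (cprod \<Delta> f g) = g"
    and mult_inv_cancel: "cprod \<Delta> f (cprod \<Delta> (f \<circ> S) g) = g"
    and mult_inv_cancel_right: "cprod \<Delta> (cprod \<Delta> g (f \<circ> S)) f = g"
    and mult_cancel_inv_right: "cprod \<Delta> (cprod \<Delta> g f) (f \<circ> S) = g"
proof -
  have R: "cprod \<Delta> (tinl \<circ> S) (cprod \<Delta> tinl tinr) = tinr"
    "cprod \<Delta> tinl (cprod \<Delta> (tinl \<circ> S) tinr) = tinr"
    and L: "cprod \<Delta> (cprod \<Delta> tinl (tinr \<circ> S)) tinr = tinl"
    "cprod \<Delta> (cprod \<Delta> tinl tinr) (tinr \<circ> S) = tinl"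
    using antipode_R1 antipode_R2 antipode_L1 antipode_L2
    by (simp_all add: tlift3_coprodR1 tlift3_coprodR2 tlift3_coprodL1 tlift3_coprodL2
        fun_eq_iff tinl_def tinr_def)
  have F: "alg_hom (copair f g)" "alg_hom (copair g f)"
    using assms by (simp_all add: ahom)
  show "cprod \<Delta> (f \<circ> S) (cprod \<Delta> f g) = g" "cprod \<Delta> f (cprod \<Delta> (f \<circ> S) g) = g"
    using R[THEN arg_cong[where f="\<lambda>u. copair f g \<circ> u"]]
    by (simp_all add: F comp_cprod clinear_compose f g flip: comp_assoc)
  show "cprod \<Delta> (cprod \<Delta> g (f \<circ> S)) f = g" "cprod \<Delta> (cprod \<Delta> g f) (f \<circ> S) = g"
    using L[THEN arg_cong[where f="\<lambda>u. copair g f \<circ> u"]]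
    by (simp_all add: F comp_cprod clinear_compose f g flip: comp_assoc)
qed

end

section \<open>The antipode of a commutative Hopf coquasigroup\<close>

locale commutative_hopf_coquasigroup = hopf_coquasigroup +
  assumes comm: "comm_alg TYPE('a)"
begin

lemma cprod_antipode: "cprod \<Delta> id S = unit_point"
  using mult_inv_cancel[OF comm, of id unit_point] by simp

text \<open>Both sides equal
  \<open>S(h\<^sub>(\<^sub>1\<^sub>)) S(k\<^sub>(\<^sub>1\<^sub>)) h\<^sub>(\<^sub>2\<^sub>)\<^sub>(\<^sub>1\<^sub>) k\<^sub>(\<^sub>2\<^sub>)\<^sub>(\<^sub>1\<^sub>) S(h\<^sub>(\<^sub>2\<^sub>)\<^sub>(\<^sub>2\<^sub>) k\<^sub>(\<^sub>2\<^sub>)\<^sub>(\<^sub>2\<^sub>))\<close>.\<close>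

lemma antipode_mult: "S (h * k) = S h * S k"
proof -
  define R where "R = copair (tinl \<circ> S) \<Delta>"
  have \<Delta>_eq: "cprod \<Delta> tinl tinr = \<Delta>"
    by (simp add: cprod_def copair_eta[of id, simplified])
  \<comment> \<open>On \<open>\<Delta> h\<close> the map \<open>R\<close> yields
    \<open>S(h\<^sub>(\<^sub>1\<^sub>)) h\<^sub>(\<^sub>2\<^sub>)\<^sub>(\<^sub>1\<^sub>) \<otimes>
    h\<^sub>(\<^sub>2\<^sub>)\<^sub>(\<^sub>2\<^sub>)\<close>, which left cancellation reduces to
    its last leg.\<close>
  have R: "R (\<Delta> h) = tinr h" for h
    using inv_mult_cancel[OF comm_alg_tensor[OF comm comm], of tinl tinr]
    by (simp add: \<Delta>_eq) (simp add: fun_eq_iff cprod_def R_def)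
  have 1: "copair id S (tinl a * w) = a * copair id S w" for a and w :: "'a \<otimes> 'a"
    by (induction w rule: tensor_induct)
      (simp_all add: tinl_def times_tensor_tensor copair_tensor distrib_left mult.assoc
        clinear_add[OF clinear_copair])
  have 2: "copair id S (\<Delta> h) = unit_point h" for h
    using cprod_antipode by (simp add: fun_eq_iff cprod_def)
  \<comment> \<open>On pure tensors the two coproducts merge into one coproduct of a product, which
    \<open>copair id S\<close> collapses to a counit. For \<open>u = \<Delta> h\<close> and
    \<open>v = \<Delta> k\<close> the left side becomes \<open>S (h * k)\<close> and the right side
    \<open>S h * S k\<close>.\<close>
  have "copair id S (R u * R v) = copair S unit_point u * copair S unit_point v" for u v
  proof (induction u rule: tensor_induct)
    case (tensor x h)
    show ?case
    proof (induction v rule: tensor_induct)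
      case (tensor y k)
      have "R (x \<otimes> h) * R (y \<otimes> k) = tinl (S x * S y) * \<Delta> (h * k)"
        using coproduct_hom comm_algD[OF comm_alg_tensor[OF comm comm]]
        by (simp add: R_def copair_tensor clinear_compose alg_hom_mult)
          (metis (no_types, lifting) mult.assoc)
      then have "copair id S (R (x \<otimes> h) * R (y \<otimes> k)) = S x * S y * unit_point (h * k)"
        by (simp add: 1 2)
      also have "\<dots> = S x * unit_point h * (S y * unit_point k)"
        using comm_algD[OF comm] by (simp add: alg_hom_mult) (metis mult.assoc)
      finally show ?case by (simp add: copair_tensor del: id_apply)
    qed (simp add: R_def distrib_left clinear_add[OF clinear_copair] clinear_compose)
  qed (simp add: R_def distrib_right clinear_add[OF clinear_copair] clinear_compose)
  note this[of "\<Delta> h" "\<Delta> k"]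
  moreover have "copair S unit_point (\<Delta> h) = S h" for h
    using cprod_unit_right[OF antipode_linear] by (simp add: cprod_def fun_eq_iff)
  moreover have "copair id S (tinr (h * k)) = S (h * k)"
    by (simp add: tinr_def copair_tensor)
  ultimately show ?thesis by (simp add: R alg_hom_mult del: id_apply)
qed

lemma alg_hom_antipode [ahom, simp]: "alg_hom S"
proof (rule alg_homI)
  have "cprod \<Delta> id S 1 = 1"
    by (simp add: cprod_antipode alg_hom_one)
  then show "S 1 = 1"
    by (simp add: cprod_def alg_hom_one[OF coproduct_hom] one_tensor_def copair_tensor)
qed (simp_all add: antipode_mult)

text \<open>Inversion reverses products in an inverse property loop. With k = f g one has k g^-1 =
  f, so k^-1 f = k^-1 (k g^-1) = g^-1, and multiplying by f^-1 on the right gives k^-1 = g^-1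
  f^-1.\<close>

lemma antipode_cprod:
  fixes f g :: "'a \<Rightarrow> 'd::complex_algebra_1"
  assumes A: "comm_alg TYPE('d)" and f: "alg_hom f" and g: "alg_hom g"
  shows "cprod \<Delta> f g \<circ> S = cprod \<Delta> (g \<circ> S) (f \<circ> S)"
proof -
  let ?k = "cprod \<Delta> f g"
  have k: "alg_hom ?k" using assms coproduct_hom by (simp add: ahom)
  have "cprod \<Delta> (?k \<circ> S) (cprod \<Delta> ?k (g \<circ> S)) = g \<circ> S"
    by (rule inv_mult_cancel) (use assms k in \<open>simp_all add: ahom\<close>)
  moreover have "cprod \<Delta> ?k (g \<circ> S) = f"
    by (rule mult_cancel_inv_right) (use assms in simp_all)
  moreover have "cprod \<Delta> (cprod \<Delta> (?k \<circ> S) f) (f \<circ> S) = ?k \<circ> S"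
    by (rule mult_cancel_inv_right) (use assms k in \<open>simp_all add: ahom\<close>)
  ultimately show ?thesis by metis
qed

end

section \<open>Nuclear points of a quasi coassociative pair\<close>

text \<open>In this locale the type of \<open>B\<close> is called 'a and that of \<open>C\<close> is
  called 'b.\<close>

locale commutative_quasi_pair = quasi_coassociative_pair +
  assumes comm_base: "comm_alg TYPE('a)"
begin

lemma phi_alg_hom [ahom, simp]: "alg_hom \<phi>"
  and phi_coproduct: "\<Delta>C (\<phi> x) = tmap \<phi> \<phi> (\<Delta>B x)"
  and phi_counit: "\<epsilon>C (\<phi> x) = \<epsilon>B x"
  using phi_hom by (simp_all add: hopf_coquasigroup_hom_def)

lemma comm_quotient [simp]: "comm_alg TYPE('b)"
  unfolding comm_alg_def
proof (intro allI)
  fix x y :: 'b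
  obtain a b where "x = \<phi> a" "y = \<phi> b"
    using phi_surj by (meson surjD)
  then show "x * y = y * x"
    using comm_algD[OF comm_base, of a b] by (simp flip: alg_hom_mult[OF phi_alg_hom])
qed

end

sublocale commutative_quasi_pair \<subseteq> B: commutative_hopf_coquasigroup \<Delta>B \<epsilon>B SB
  by unfold_locales (rule comm_base)

sublocale commutative_quasi_pair \<subseteq> C: commutative_hopf_coquasigroup \<Delta>C \<epsilon>C SC
  by (rule commutative_hopf_coquasigroup.intro[OF C.hopf_coquasigroup])
    (rule commutative_hopf_coquasigroup_axioms.intro[OF comm_quotient])

context commutative_quasi_pair
begin

declare comm_base [simp]

lemmas [simp] = B.coproduct_hom C.coproduct_hom B.counit_hom C.counit_hom
lemmas [ahom] = B.coproduct_hom C.coproduct_hom B.counit_hom C.counit_hom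

section \<open>Points of \<open>B\<close> and points that factor through \<open>C\<close>\<close>

abbreviation point_mult  (infixl "\<cdot>" 54)
  where "f \<cdot> g \<equiv> cprod \<Delta>B f g"

lemma cprod_quotient:
  "clinear f \<Longrightarrow> clinear g \<Longrightarrow> cprod \<Delta>C f g \<circ> \<phi> = (f \<circ> \<phi>) \<cdot> (g \<circ> \<phi>)"
  by (rule cprod_hom) (simp_all add: phi_coproduct)

lemma unit_point_quotient: "C.unit_point \<circ> \<phi> = B.unit_point"
  by (simp add: fun_eq_iff C.unit_point_def B.unit_point_def phi_counit)

text \<open>Morphisms are only required to respect coproducts and counits. Here
  \<open>SC \<circ> \<phi>\<close> is a left inverse of the point \<open>\<phi>\<close>, and
  cancelling \<open>\<phi>\<close> on the right identifies it with
  \<open>\<phi> \<circ> SB\<close>.\<close>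

lemma phi_antipode: "\<phi> \<circ> SB = SC \<circ> \<phi>"
proof -
  have "(SC \<circ> \<phi>) \<cdot> \<phi> = cprod \<Delta>C SC id \<circ> \<phi>"
    by (simp add: cprod_quotient)
  also have "\<dots> = B.unit_point"
    using C.antipode_unit(1)[of id] by (simp add: unit_point_quotient)
  finally have "((SC \<circ> \<phi>) \<cdot> \<phi>) \<cdot> (\<phi> \<circ> SB) = \<phi> \<circ> SB"
    by (simp add: clinear_compose)
  then show ?thesis
    using B.mult_cancel_inv_right[OF comm_quotient, of \<phi> "SC \<circ> \<phi>"] by (simp add: ahom)
qed

text \<open>These points form the subgroup N; they are the points factoring through
  \<open>C\<close>, see \<open>nuclear_cases\<close>. The name anticipates
  \<open>nuclear_assoc\<close>.\<close>

definition nuclear :: "('a \<Rightarrow> 'd::complex_algebra_1) \<Rightarrow> bool"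
  where "nuclear f \<longleftrightarrow> alg_hom f \<and> (\<forall>i. \<phi> i = 0 \<longrightarrow> f i = 0)"

text \<open>The factorisation through the surjection \<open>\<phi>\<close>. The preimage chosen by
  \<open>inv \<phi>\<close> does not matter for maps that vanish on the kernel, which is the content
  of \<open>descend_phi\<close>.\<close>

definition descend :: "('a \<Rightarrow> 'd) \<Rightarrow> 'b \<Rightarrow> 'd"
  where "descend f = f \<circ> inv \<phi>"

lemma nuclear_alg_hom [simp]: "nuclear f \<Longrightarrow> alg_hom f"
  by (simp add: nuclear_def)

lemma nuclear_quotient: "alg_hom \<nu> \<Longrightarrow> nuclear (\<nu> \<circ> \<phi>)"
  by (simp add: nuclear_def ahom clinear_0)

lemma descend_phi:
  assumes "nuclear f"
  shows "descend f (\<phi> b) = f b"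
proof -
  have "\<phi> (inv \<phi> (\<phi> b) - b) = 0"
    by (simp add: clinear_diff surj_f_inv_f[OF phi_surj])
  then have "f (inv \<phi> (\<phi> b) - b) = 0"
    using assms by (simp add: nuclear_def)
  then show ?thesis
    using assms by (simp add: descend_def clinear_diff)
qed

lemma descend_comp_phi: "nuclear f \<Longrightarrow> descend f \<circ> \<phi> = f"
  by (simp add: fun_eq_iff descend_phi)

lemma comp_phi_cancel: "f \<circ> \<phi> = g \<circ> \<phi> \<Longrightarrow> f = g"
  using phi_surj by (metis comp_apply ext surjD)

lemma alg_hom_descend [ahom, simp]:
  assumes "nuclear f"
  shows "alg_hom (descend f)"
proof (rule alg_homI)
  have ex: "\<exists>b. c = \<phi> b" for c
    using phi_surj by (metis surjD)
  note d = descend_phi[OF assms] and f = nuclear_alg_hom[OF assms]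
  show "descend f (x * y) = descend f x * descend f y" for x y
    using ex[of x] ex[of y] d alg_hom_mult[OF f] alg_hom_mult[OF phi_alg_hom] by metis
  show "descend f 1 = 1"
    using d[of 1] by (simp add: alg_hom_one f)
  have "descend f (x + y) = descend f x + descend f y" for x y
    using ex[of x] ex[of y] d alg_hom_add[OF f] alg_hom_add[OF phi_alg_hom] by metis
  moreover have "descend f (c *\<^sub>C x) = c *\<^sub>C descend f x" for c x
    using ex[of x] d alg_hom_scale[OF f] alg_hom_scale[OF phi_alg_hom] by metis
  ultimately show "clinear (descend f)"
    by (simp add: clinear_iff)
qed

lemma nuclear_cases:
  assumes "nuclear f"
  obtains \<nu> where "alg_hom \<nu>" "f = \<nu> \<circ> \<phi>"
  using assms alg_hom_descend descend_comp_phi by metis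

text \<open>Once \<open>n\<close> is written as a map on \<open>C\<close> after
  \<open>\<phi>\<close>, the triple product sees the iterated coproducts only through
  \<open>\<phi>\<close> on the leg of \<open>n\<close>, and there the pair axioms make them
  equal.\<close>

lemma nuclear_assoc:
  fixes f g n :: "'a \<Rightarrow> 'd::complex_algebra_1"
  assumes "nuclear n" "alg_hom f" "alg_hom g"
  shows nuclear_assoc1: "(n \<cdot> f) \<cdot> g = n \<cdot> (f \<cdot> g)"
    and nuclear_assoc2: "(f \<cdot> n) \<cdot> g = f \<cdot> (n \<cdot> g)"
proof -
  obtain \<nu> where \<nu>: "alg_hom \<nu>" "n = \<nu> \<circ> \<phi>"
    using assms by (meson nuclear_cases)
  have "copair n (copair f g) w = copair \<nu> (copair f g) (tmap \<phi> id w)"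
    "copair f (copair n g) w = copair f (copair \<nu> g) (tmap id (tmap \<phi> id) w)" for w
    using \<nu> assms by (simp_all add: copair_comp_tmap clinear_tmap clinear_compose)
      (simp_all add: o_def[of "copair _ _"] copair_comp_tmap)
  then show "(n \<cdot> f) \<cdot> g = n \<cdot> (f \<cdot> g)" "(f \<cdot> n) \<cdot> g = f \<cdot> (n \<cdot> g)"
    using assms coassoc_leg1 coassoc_leg2
    by (simp_all add: fun_eq_iff cprod_cprod_left cprod_cprod_right)
qed

text \<open>Brings the word g n g^-1 into the shape of the expression in \<open>kernel_adL\<close>.
  Commutativity of the target lets the value of n move past that of g^-1.\<close>

lemma conjugate_eq_lift:
  fixes g n :: "'a \<Rightarrow> 'd::complex_algebra_1"
  assumes "comm_alg TYPE('d)" "alg_hom g" "clinear n"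
  shows "(g \<cdot> n) \<cdot> (g \<circ> SB) = copair g n \<circ> tlift3 (\<lambda>x y z. (x * SB z) \<otimes> y) \<circ> coprodL \<Delta>B"
proof -
  have "tlift3 (\<lambda>x (y::'a) z. (x * SB z) \<otimes> y) = copair tinl (copair tinr (tinl \<circ> SB))"
    by (rule tlift3_eq_copair)
      (simp_all add: clinear_compose tinl_def tinr_def times_tensor_tensor)
  moreover have "copair g n (copair tinl (copair tinr (tinl \<circ> SB)) w) = copair g (copair n (g \<circ> SB)) w" for w
  proof (induction w rule: tensor3_induct)
    case (tensor a b c)
    have "copair tinl (copair tinr (tinl \<circ> SB)) (a \<otimes> b \<otimes> c) = (a * SB c) \<otimes> b"
      by (simp add: copair_tensor clinear_compose del: o_apply)
        (simp add: tinl_def tinr_def times_tensor_tensor)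
    then show ?case
      using assms comm_algD[OF assms(1), of "n b"]
      by (simp add: copair_tensor clinear_compose alg_hom_mult mult.assoc del: o_apply) simp
  qed (use assms in \<open>simp add: clinear_add[OF clinear_copair] clinear_compose del: o_apply\<close>)
  ultimately show ?thesis
    using assms by (intro ext) (simp add: cprod_cprod_left clinear_compose)
qed

text \<open>This is normality of N. On the kernel the adjoint expression lies in the span of tensors
  with second leg in the kernel, and \<open>copair g n\<close> kills that span because
  \<open>n\<close> does.\<close>

lemma nuclear_conjugate:
  fixes g n :: "'a \<Rightarrow> 'd::complex_algebra_1"
  assumes A: "comm_alg TYPE('d)" and g: "alg_hom g" and n: "nuclear n"
  shows "nuclear ((g \<cdot> n) \<cdot> (g \<circ> SB))"
  unfolding nuclear_def
proof (intro conjI allI impI)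
  show "alg_hom ((g \<cdot> n) \<cdot> (g \<circ> SB))"
    using assms by (simp add: ahom)
  fix i assume "\<phi> i = 0"
  interpret L: Vector_Spaces.linear scaleC scaleC "copair g n"
    using g n by simp
  have "copair g n w = 0" if "w \<in> cspan {x \<otimes> y | x y. \<phi> y = 0}" for w
    by (rule L.eq_0_on_span[OF _ that]) (use g n in \<open>auto simp: copair_tensor nuclear_def\<close>)
  with kernel_adL[OF \<open>\<phi> i = 0\<close>] show "((g \<cdot> n) \<cdot> (g \<circ> SB)) i = 0"
    by (subst conjugate_eq_lift) (use A g n in auto)
qed

lemma conjugate_mult:
  fixes g n :: "'a \<Rightarrow> 'd::complex_algebra_1"
  assumes "comm_alg TYPE('d)" "alg_hom g" "alg_hom n"
  shows "(g \<cdot> n) \<cdot> (g \<circ> SB) \<cdot> g = g \<cdot> n"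
  using assms by (intro B.mult_inv_cancel_right) (simp_all add: ahom)

text \<open>For the three universal points x, y, z of \<open>B\<close> with values in the triple
  tensor product, this is (x (y z)) ((x y) z)^-1, the associator of the loop.\<close>

lemma coassociator_eq:
  "coassociator \<Delta>B SB = coprodR \<Delta>B \<cdot> (coprodL \<Delta>B \<circ> SB)"
  by (simp add: fun_eq_iff coassociator_def cprod_def copair_def)

lemma alg_hom_coprodL [ahom, simp]: "alg_hom (coprodL \<Delta>B)"
  and alg_hom_coprodR [ahom, simp]: "alg_hom (coprodR \<Delta>B)"
  by (simp_all add: coprodL_eq coprodR_eq ahom)

lemma nuclear_coassociator: "nuclear (coassociator \<Delta>B SB)"
  unfolding nuclear_def using kernel_coassociator
  by (simp add: coassociator_eq ahom)

lemma coassociator_mult: "coassociator \<Delta>B SB \<cdot> coprodL \<Delta>B = coprodR \<Delta>B"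
  unfolding coassociator_eq by (rule B.mult_inv_cancel_right) (simp_all add: ahom)

section \<open>The structure maps\<close>

text \<open>The conjugate g n g^-1 for the universal point g of \<open>B\<close> and the universal
  nuclear point n. It passes to \<open>C\<close> because conjugates of nuclear points are
  nuclear.\<close>

definition Ad :: "'b \<Rightarrow> 'a \<otimes> 'b"
  where "Ad = descend ((tinl \<cdot> (tinr \<circ> \<phi>)) \<cdot> (tinl \<circ> SB))"

definition source :: "'a \<Rightarrow> 'b \<otimes> 'a"
  where "source = tmap \<phi> id \<circ> \<Delta>B"

abbreviation target :: "'a \<Rightarrow> 'b \<otimes> 'a"
  where "target \<equiv> tinr"

text \<open>The coproduct is dual to the product \<open>(n, g) (m, h) = (n (g m g\<^sup>-\<^sup>1), g h)\<close>, and the antipode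
  to the inverse \<open>(n, g)\<^sup>-\<^sup>1 = (g\<^sup>-\<^sup>1 n\<^sup>-\<^sup>1 g, g\<^sup>-\<^sup>1)\<close>.\<close>

definition coproduct_H :: "'b \<otimes> 'a \<Rightarrow> ('b \<otimes> 'a) \<otimes> ('b \<otimes> 'a)"
  where "coproduct_H = copair
    (cprod \<Delta>C (tinl \<circ> tinl) (copair (tinl \<circ> tinr) (tinr \<circ> tinl) \<circ> Ad))
    ((tinl \<circ> tinr) \<cdot> (tinr \<circ> tinr))"

definition counit_H :: "'b \<otimes> 'a \<Rightarrow> complex"
  where "counit_H = copair \<epsilon>C \<epsilon>B"

definition antipode_H :: "'b \<otimes> 'a \<Rightarrow> 'b \<otimes> 'a"
  where "antipode_H = copair (copair (tinr \<circ> SB) (tinl \<circ> SC) \<circ> Ad) (tinr \<circ> SB)"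

text \<open>Dual to the identity arrow (1, g) at g.\<close>

definition counit_arrow :: "'b \<otimes> 'a \<Rightarrow> 'a"
  where "counit_arrow = copair C.unit_point id"

text \<open>Dual to reversing an arrow: (n, g) goes to (n^-1, n g).\<close>

definition antipode_arrow :: "'b \<otimes> 'a \<Rightarrow> 'b \<otimes> 'a"
  where "antipode_arrow = copair (tinl \<circ> SC) source"

text \<open>Dual to the arrow from x (y z) to (x y) z whose component in N is the associator of x,
  y, z.\<close>

definition associator :: "'b \<otimes> 'a \<Rightarrow> 'a \<otimes> 'a \<otimes> 'a"
  where "associator = copair (descend (coassociator \<Delta>B SB)) (coprodL \<Delta>B)"

section \<open>The structure maps are algebra maps\<close>

lemma nuclear_Ad: "nuclear ((tinl \<cdot> (tinr \<circ> \<phi>)) \<cdot> (tinl \<circ> SB))"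
  by (rule nuclear_conjugate) (simp_all add: nuclear_quotient)

lemma alg_hom_Ad [ahom, simp]: "alg_hom Ad"
  by (simp add: Ad_def nuclear_Ad)

lemma alg_hom_source [ahom, simp]: "alg_hom source"
  by (simp add: source_def ahom)

lemma alg_hom_coproduct_H [ahom, simp]: "alg_hom coproduct_H"
  by (simp add: coproduct_H_def ahom)

lemma alg_hom_counit_H [ahom, simp]: "alg_hom counit_H"
  by (simp add: counit_H_def ahom)

lemma alg_hom_antipode_H [ahom, simp]: "alg_hom antipode_H"
  by (simp add: antipode_H_def ahom)

lemma alg_hom_counit_arrow [ahom, simp]: "alg_hom counit_arrow"
  by (simp add: counit_arrow_def ahom)

lemma alg_hom_antipode_arrow [ahom, simp]: "alg_hom antipode_arrow"
  by (simp add: antipode_arrow_def ahom)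

lemma alg_hom_associator [ahom, simp]: "alg_hom associator"
  by (simp add: associator_def ahom nuclear_coassociator)

lemma copair_Ad_phi:
  fixes f :: "'a \<Rightarrow> 'd::complex_algebra_1"
  assumes "comm_alg TYPE('d)" "alg_hom f" "alg_hom \<nu>"
  shows "copair f \<nu> \<circ> Ad \<circ> \<phi> = (f \<cdot> (\<nu> \<circ> \<phi>)) \<cdot> (f \<circ> SB)"
proof -
  have "copair f \<nu> \<circ> ((tinl \<cdot> (tinr \<circ> \<phi>)) \<cdot> (tinl \<circ> SB)) =
      ((copair f \<nu> \<circ> tinl) \<cdot> (copair f \<nu> \<circ> tinr \<circ> \<phi>)) \<cdot> (copair f \<nu> \<circ> tinl \<circ> SB)"
    using assms by (simp add: comp_cprod ahom comp_assoc)
  then show ?thesis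
    using assms by (simp add: Ad_def descend_comp_phi nuclear_Ad comp_assoc)
qed

lemma source_eq: "source = (tinl \<circ> \<phi>) \<cdot> tinr"
  by (simp add: source_def tmap_coproduct)

lemma comp_source:
  "alg_hom F \<Longrightarrow> F \<circ> source = (F \<circ> tinl \<circ> \<phi>) \<cdot> (F \<circ> tinr)"
  by (simp add: source_eq comp_cprod ahom comp_assoc)

lemma copair_source:
  "alg_hom \<nu> \<Longrightarrow> alg_hom g \<Longrightarrow> comm_alg TYPE('d) \<Longrightarrow>
    copair \<nu> g \<circ> source = (\<nu> \<circ> \<phi>) \<cdot> (g :: 'a \<Rightarrow> 'd::complex_algebra_1)"
  by (simp add: comp_source ahom)

text \<open>An arrow of the action groupoid is determined by its source and its target.\<close>

lemma source_target_eqI: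
  fixes F G :: "'b \<otimes> 'a \<Rightarrow> 'd::complex_algebra_1"
  assumes A: "comm_alg TYPE('d)" and F: "alg_hom F" and G: "alg_hom G"
    and s: "F \<circ> source = G \<circ> source" and t: "F \<circ> target = G \<circ> target"
  shows "F = G"
proof -
  \<comment> \<open>This is the recovery of the component in N: n = (n g) g^-1 by right
    cancellation.\<close>
  have *: "(K \<circ> source) \<cdot> (K \<circ> target \<circ> SB) = K \<circ> tinl \<circ> \<phi>"
    if "alg_hom K" for K :: "'b \<otimes> 'a \<Rightarrow> 'd"
    using that A by (simp add: comp_source B.mult_cancel_inv_right ahom)
  have "F \<circ> tinl \<circ> \<phi> = G \<circ> tinl \<circ> \<phi>"
    using *[OF F] *[OF G] s t by simp
  then show ?thesis
    by (intro alg_hom_tensor_eqI[OF F G] t comp_phi_cancel)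
qed

section \<open>Restriction of the structure maps along source and target\<close>

lemma coproduct_H_target: "coproduct_H \<circ> target = tmap target target \<circ> \<Delta>B"
  by (simp add: coproduct_H_def ahom tmap_coproduct)

text \<open>Multiplying arrows multiplies their sources: (n m') (g h) = (n g) (m h) with m' = g m
  g^-1. Every change of brackets has one of the nuclear points n, m', m at stake, and m' g = g
  m.\<close>

lemma coproduct_H_source: "coproduct_H \<circ> source = tmap source source \<circ> \<Delta>B"
proof -
  define n g m h :: "'a \<Rightarrow> ('b \<otimes> 'a) \<otimes> ('b \<otimes> 'a)"
    where "n = tinl \<circ> tinl \<circ> \<phi>" and "g = tinl \<circ> tinr" and "m = tinr \<circ> tinl \<circ> \<phi>"
      and "h = tinr \<circ> tinr"
  have N: "nuclear n" "nuclear m"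
    unfolding n_def m_def by (intro nuclear_quotient ahom)+
  have gh: "alg_hom g" "alg_hom h"
    by (simp_all add: g_def h_def ahom)
  define m' where "m' = (g \<cdot> m) \<cdot> (g \<circ> SB)"
  have m': "nuclear m'" "m' \<cdot> g = g \<cdot> m"
    unfolding m'_def using N gh by (intro nuclear_conjugate conjugate_mult; simp)+
  have "coproduct_H \<circ> source = (n \<cdot> m') \<cdot> (g \<cdot> h)"
    by (simp add: coproduct_H_def copair_source ahom cprod_quotient copair_Ad_phi
        n_def m'_def g_def m_def h_def comp_assoc)
      (simp add: copair_Ad_phi ahom flip: comp_assoc)
  also have "\<dots> = n \<cdot> (m' \<cdot> (g \<cdot> h))"
    using N m' gh by (intro nuclear_assoc1) (simp_all add: ahom)
  also have "m' \<cdot> (g \<cdot> h) = (g \<cdot> m) \<cdot> h"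
    using m' gh by (simp add: nuclear_assoc1 flip: m'(2))
  also have "\<dots> = g \<cdot> (m \<cdot> h)"
    using N gh by (intro nuclear_assoc2) simp_all
  also have "n \<cdot> (g \<cdot> (m \<cdot> h)) = (n \<cdot> g) \<cdot> (m \<cdot> h)"
    using N gh by (intro nuclear_assoc1[symmetric]) (simp_all add: ahom)
  also have "\<dots> = tmap source source \<circ> \<Delta>B"
    by (simp add: tmap_coproduct comp_source n_def m_def g_def h_def)
  finally show ?thesis .
qed

lemma counit_H_target: "counit_H \<circ> target = \<epsilon>B"
  by (simp add: counit_H_def)

lemma counit_H_source: "counit_H \<circ> source = \<epsilon>B"
proof -
  have "\<epsilon>C \<circ> \<phi> = B.unit_point"
    by (simp add: fun_eq_iff phi_counit B.unit_point_eq_counit)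
  then show ?thesis
    by (simp add: counit_H_def copair_source)
qed

lemma antipode_H_target: "antipode_H \<circ> target = target \<circ> SB"
  by (simp add: antipode_H_def ahom)

text \<open>With h = g^-1 the source of the inverse is (h n^-1 h^-1) h = h n^-1, and this is (n
  g)^-1 because inversion reverses products.\<close>

lemma antipode_H_source: "antipode_H \<circ> source = source \<circ> SB"
proof -
  let ?n = "tinl \<circ> \<phi> \<circ> SB" and ?h = "tinr \<circ> SB :: 'a \<Rightarrow> 'b \<otimes> 'a"
  have "antipode_H \<circ> source = (?h \<cdot> ?n) \<cdot> (?h \<circ> SB) \<cdot> ?h"
    by (simp add: antipode_H_def copair_source copair_Ad_phi ahom)
      (simp add: comp_assoc phi_antipode)
  also have "\<dots> = ?h \<cdot> ?n"
    by (rule conjugate_mult) (simp_all add: ahom)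
  also have "\<dots> = source \<circ> SB"
    by (simp add: source_eq B.antipode_cprod ahom)
  finally show ?thesis .
qed

lemma counit_arrow_target: "counit_arrow \<circ> target = id"
  by (simp add: counit_arrow_def)

lemma counit_arrow_source: "counit_arrow \<circ> source = id"
  by (simp add: counit_arrow_def copair_source unit_point_quotient)

lemma antipode_arrow_target: "antipode_arrow \<circ> target = source"
  by (simp add: antipode_arrow_def ahom)

lemma antipode_arrow_source: "antipode_arrow \<circ> source = target"
proof -
  have "antipode_arrow \<circ> source = (tinl \<circ> \<phi> \<circ> SB) \<cdot> source"
    by (simp add: antipode_arrow_def copair_source ahom) (simp add: comp_assoc phi_antipode)
  also have "\<dots> = target"
    unfolding source_eq by (rule B.inv_mult_cancel) (simp_all add: ahom)
  finally show ?thesis .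
qed

lemma associator_target: "associator \<circ> target = coprodL \<Delta>B"
  by (simp add: associator_def nuclear_coassociator)

lemma associator_source: "associator \<circ> source = coprodR \<Delta>B"
  by (simp add: associator_def copair_source nuclear_coassociator descend_comp_phi
      coassociator_mult)

section \<open>The Hopf coquasigroup on \<open>H\<close>\<close>

lemma cprod_H_source:
    "clinear f \<Longrightarrow> clinear g \<Longrightarrow> cprod coproduct_H f g \<circ> source = (f \<circ> source) \<cdot> (g \<circ> source)"
  and cprod_H_target:
    "clinear f \<Longrightarrow> clinear g \<Longrightarrow> cprod coproduct_H f g \<circ> target = (f \<circ> target) \<cdot> (g \<circ> target)"
  using coproduct_H_source coproduct_H_target
  by (intro cprod_hom; simp add: fun_eq_iff)+

sublocale H: counital_bialgebra coproduct_H counit_H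
proof
  have l: "cprod coproduct_H (\<lambda>x. counit_H x *\<^sub>C 1) id = id" (is "?L = _")
    and r: "cprod coproduct_H id (\<lambda>x. counit_H x *\<^sub>C 1) = id" (is "?R = _")
  proof -
    \<comment> \<open>The unit point of \<open>H\<close>, spelled out because the named constant is
      available only after this instance has been established.\<close>
    let ?e = "\<lambda>x. counit_H x *\<^sub>C (1::'b \<otimes> 'a)"
    have e: "alg_hom ?e"
    proof (rule alg_homI)
      show "clinear ?e"
        by (simp add: clinear_iff alg_hom_add alg_hom_scale scaleC_add_left scaleC_scaleC
          scaleC_complex_def)
    qed (simp_all add: alg_hom_one alg_hom_mult scaleC_one mult_scaleC_left mult_scaleC_right
        scaleC_scaleC)
    have es: "?e \<circ> source = B.unit_point" "?e \<circ> target = B.unit_point"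
      using counit_H_source counit_H_target by (simp_all add: fun_eq_iff B.unit_point_def)
    show "?L = id"
      by (rule source_target_eqI)
        (simp_all add: e ahom cprod_H_source cprod_H_target es del: o_apply)
    show "?R = id"
      by (rule source_target_eqI)
        (simp_all add: e ahom cprod_H_source cprod_H_target es del: o_apply)
  qed
  have [simp]: "tlift (\<lambda>x y. counit_H x *\<^sub>C y) = copair (\<lambda>x. counit_H x *\<^sub>C 1) id"
     "tlift (\<lambda>x y. counit_H y *\<^sub>C x) = copair id (\<lambda>x. counit_H x *\<^sub>C 1)"
    by (simp_all add: copair_def mult_scaleC_left mult_scaleC_right)
  show "tlift (\<lambda>x y. counit_H x *\<^sub>C y) (coproduct_H h) = h"
    "tlift (\<lambda>x y. counit_H y *\<^sub>C x) (coproduct_H h) = h" for h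
    using l r by (simp_all add: cprod_def fun_eq_iff)
qed simp_all

text \<open>Source and target are homomorphisms for products and inverses, so each inverse property
  for \<open>H\<close> follows from the same property of \<open>B\<close>, used once for sources and
  once for targets.\<close>

lemma hopf_coquasigroup_H: "hopf_coquasigroup coproduct_H counit_H antipode_H"
proof (rule H.hopf_coquasigroupI)
  note simps = ahom comp_assoc cprod_H_source cprod_H_target antipode_H_source antipode_H_target
  note cancel = B.inv_mult_cancel B.mult_inv_cancel B.mult_inv_cancel_right
    B.mult_cancel_inv_right
  show "cprod coproduct_H (tinl \<circ> antipode_H) (cprod coproduct_H tinl tinr) = tinr"
    by (rule source_target_eqI; simp add: simps; simp add: ahom cancel flip: comp_assoc)
  show "cprod coproduct_H tinl (cprod coproduct_H (tinl \<circ> antipode_H) tinr) = tinr"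
    by (rule source_target_eqI; simp add: simps; simp add: ahom cancel flip: comp_assoc)
  show "cprod coproduct_H (cprod coproduct_H tinl (tinr \<circ> antipode_H)) tinr = tinl"
    by (rule source_target_eqI; simp add: simps; simp add: ahom cancel flip: comp_assoc)
  show "cprod coproduct_H (cprod coproduct_H tinl tinr) (tinr \<circ> antipode_H) = tinl"
    by (rule source_target_eqI; simp add: simps; simp add: ahom cancel flip: comp_assoc)
qed simp

end

section \<open>Balanced tensor products as quotients\<close>

lemma span_mem_image:
  assumes "clinear F" "\<And>x. x \<in> G \<Longrightarrow> F x \<in> cspan G'" "x \<in> cspan G"
  shows "F x \<in> cspan G'"
  using assms(3)
proof (induction rule: cvec.span_induct_alt)
  case base
  show ?case using assms(1) by (simp add: clinear_0 cvec.span_zero)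
next
  case (step c x y)
  then show ?case
    using assms(1,2) by (simp add: clinear_add clinear_scale cvec.span_add cvec.span_scale)
qed

lemma span_vanish:
  assumes "clinear F" "\<And>x. x \<in> G \<Longrightarrow> F x = 0" "x \<in> cspan G"
  shows "F x = 0"
  using span_mem_image[of F G "{}"] assms by simp

text \<open>If x is congruent to \<open>\<sigma> v\<close> modulo \<open>J\<close>, then P x = v;
  hence P x = 0 forces v = 0 and puts x into \<open>J\<close>.\<close>

lemma kernel_eqI:
  assumes P: "clinear P" and J: "J = cspan G"
    and vanish: "\<And>x. x \<in> G \<Longrightarrow> P x = 0"
    and split: "clinear \<sigma>" "\<And>v. P (\<sigma> v) = v"
    and normal: "\<And>x. \<exists>v. x - \<sigma> v \<in> J"
  shows "x \<in> J \<longleftrightarrow> P x = 0"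
proof
  show "P x = 0" if "x \<in> J"
    using span_vanish[OF P vanish] that J by blast
  assume "P x = 0"
  obtain v where v: "x - \<sigma> v \<in> J"
    using normal by blast
  then have "P (x - \<sigma> v) = 0"
    using span_vanish[OF P vanish] J by blast
  then have "v = 0"
    using P split(2) \<open>P x = 0\<close> by (simp add: clinear_diff)
  then show "x \<in> J"
    using v split(1) by (simp add: clinear_0)
qed

text \<open>Cosets of a kernel are fibres, so equality of two classes can be tested on values of
  \<open>P\<close>.\<close>

lemma mod_by_fiber:
  assumes "clinear P" "\<And>x. x \<in> J \<longleftrightarrow> P x = 0" "A \<noteq> {}" "\<And>x. x \<in> A \<Longrightarrow> P x = v"
  shows "mod_by J A = {y. P y = v}"
  using assms by (auto simp: mod_by_def clinear_diff)

text \<open>All representatives offered by \<open>F\<close> and \<open>G\<close> have the same image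
  under \<open>P\<close> and \<open>Q\<close>. Summing over the legs leaves only the element of
  \<open>X\<close> that was presented, not its presentation.\<close>

lemma tmap_set_fiber:
  assumes "clinear P" "clinear Q" "clinear f" "clinear g"
    and F: "\<And>x. F x \<subseteq> {u. P u = f x}" and G: "\<And>y. G y \<subseteq> {v. Q v = g y}"
    and z: "z \<in> tmap_set F G X"
  shows "\<exists>x\<in>X. tmap P Q z = tmap f g x"
proof -
  obtain n :: nat and a b u v where z: "z = (\<Sum>i<n. u i \<otimes> v i)" and X: "(\<Sum>i<n. a i \<otimes> b i) \<in> X"
    and uv: "\<forall>i<n. u i \<in> F (a i) \<and> v i \<in> G (b i)"
    using z unfolding tmap_set_def by blast
  have "tmap P Q z = (\<Sum>i<n. P (u i) \<otimes> Q (v i))"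
    using assms by (simp add: z clinear_sum[OF clinear_tmap] tmap_tensor)
  also have "\<dots> = (\<Sum>i<n. f (a i) \<otimes> g (b i))"
  proof (intro sum.cong refl)
    fix i assume "i \<in> {..<n}"
    then have "P (u i) = f (a i)" "Q (v i) = g (b i)"
      using uv F G by blast+
    then show "P (u i) \<otimes> Q (v i) = f (a i) \<otimes> g (b i)" by simp
  qed
  also have "\<dots> = tmap f g (\<Sum>i<n. a i \<otimes> b i)"
    using assms by (simp add: clinear_sum[OF clinear_tmap] tmap_tensor)
  finally show ?thesis using X by blast
qed

lemma tensor_sum_repr: "\<exists>(n::nat) a b. x = (\<Sum>i<n. a i \<otimes> b i)"
proof (induction x rule: tensor_induct)
  case (tensor a b)
  show ?case by (rule exI[of _ 1]) auto
next
  case (add x y)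
  then obtain n m :: nat and a b c d
    where x: "x = (\<Sum>i<n. a i \<otimes> b i)" and y: "y = (\<Sum>i<m. c i \<otimes> d i)" by blast
  \<comment> \<open>The two families of summands are concatenated, the second one shifted by
    \<open>n\<close>.\<close>
  let ?a = "\<lambda>i. if i < n then a i else c (i - n)" and ?b = "\<lambda>i. if i < n then b i else d (i - n)"
  have split: "(\<Sum>i<n + m. f i) = (\<Sum>i<n. f i) + (\<Sum>i<m. f (n + i))" for f :: "nat \<Rightarrow> 'a \<otimes> 'b"
    by (induction m) (simp_all add: add.assoc)
  have "(\<Sum>i<n + m. ?a i \<otimes> ?b i) = x + y"
    unfolding split x y by simp
  then show ?case
    by (intro exI[of _ "n + m"] exI[of _ ?a] exI[of _ ?b]) (rule sym)
qed

text \<open>Required because \<open>mod_by\<close> of the empty set is empty rather than a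
  coset.\<close>

lemma tmap_set_nonempty:
  assumes "X \<noteq> {}" "\<And>x. F x \<noteq> {}" "\<And>y. G y \<noteq> {}"
  shows "tmap_set F G X \<noteq> {}"
proof -
  obtain x where "x \<in> X" using assms by blast
  then obtain n :: nat and a b where "(\<Sum>i<n. a i \<otimes> b i) \<in> X"
    using tensor_sum_repr[of x] by blast
  moreover have "\<forall>x. \<exists>u. u \<in> F x" "\<forall>y. \<exists>v. v \<in> G y"
    using assms by blast+
  then obtain u v where "\<forall>x. u x \<in> F x" "\<forall>y. v y \<in> G y"
    by metis
  ultimately have "(\<Sum>i<n. u (a i) \<otimes> v (b i)) \<in> tmap_set F G X"
    unfolding tmap_set_def mem_Collect_eq
    by (intro exI[of _ n] exI[of _ a] exI[of _ b] exI[of _ "\<lambda>i. u (a i)"]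
        exI[of _ "\<lambda>i. v (b i)"]) simp
  then show ?thesis by blast
qed

context commutative_quasi_pair
begin

abbreviation (input) "J2 \<equiv> bal2 source target"
abbreviation (input) "J3 \<equiv> bal3 source target"
abbreviation (input) "J22 \<equiv> bal22 source target"

text \<open>\<open>(n, m, h) \<in> N \<times> N \<times> G\<close> parametrises the composable pair \<open>(n, m h)\<close>, \<open>(m, h)\<close>; dually,
  \<open>proj2\<close> identifies \<open>H \<otimes>\<^sub>B H\<close> with \<open>C \<otimes> C \<otimes> B\<close>. Likewise \<open>proj3\<close> for composable triples.\<close>

definition proj2 :: "('b \<otimes> 'a) \<otimes> ('b \<otimes> 'a) \<Rightarrow> 'b \<otimes> 'b \<otimes> 'a"
  where "proj2 = copair (copair tinl (tinr \<circ> source)) tinr"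

text \<open>A normal form for classes: every class has a unique representative whose first leg has
  trivial component in \<open>B\<close>.\<close>

definition sec2 :: "'b \<otimes> 'b \<otimes> 'a \<Rightarrow> ('b \<otimes> 'a) \<otimes> ('b \<otimes> 'a)"
  where "sec2 = tmap tinl id"

definition proj3 :: "('b \<otimes> 'a) \<otimes> ('b \<otimes> 'a) \<otimes> ('b \<otimes> 'a) \<Rightarrow> 'b \<otimes> 'b \<otimes> 'b \<otimes> 'a"
  where "proj3 = copair (copair tinl (tinr \<circ> proj2 \<circ> tinl \<circ> source)) (tinr \<circ> proj2)"

lemma alg_hom_proj2 [ahom, simp]: "alg_hom proj2"
  by (simp add: proj2_def ahom)

lemma alg_hom_sec2 [ahom, simp]: "alg_hom sec2"
  by (simp add: sec2_def ahom)

lemma alg_hom_proj3 [ahom, simp]: "alg_hom proj3"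
  by (simp add: proj3_def ahom)

lemma proj2_tinl: "proj2 \<circ> tinl = copair tinl (tinr \<circ> source)"
  and proj2_tinr: "proj2 \<circ> tinr = tinr"
  by (simp_all add: proj2_def ahom)

lemma proj2_tensor: "proj2 (x \<otimes> y) = proj2 (tinl x) * tinr y"
proof -
  have "proj2 (x \<otimes> y) = proj2 (tinl x) * proj2 (tinr y)"
    by (simp flip: alg_hom_mult)
  then show ?thesis
    using proj2_tinr by (simp add: fun_eq_iff)
qed

lemma proj2_sec2: "proj2 (sec2 v) = v"
proof -
  have "proj2 \<circ> tinl \<circ> tinl = tinl"
    by (simp add: proj2_tinl ahom)
  then have [simp]: "proj2 (tinl (tinl c)) = tinl c" for c
    by (simp add: fun_eq_iff)
  have "proj2 \<circ> sec2 = id"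
  proof (rule clinear_tensor_eqI)
    show "(proj2 \<circ> sec2) (c \<otimes> x) = id (c \<otimes> x)" for c x
      by (simp add: sec2_def tmap_tensor proj2_tensor)
  qed (simp_all add: clinear_compose)
  then show ?thesis by (simp add: fun_eq_iff)
qed

text \<open>The two legs of \<open>proj2\<close> form the universal composable pair: the first arrow
  ends where the second begins.\<close>

lemma proj2_balanced: "proj2 (tinl (target b)) = proj2 (tinr (source b))"
proof -
  have "proj2 \<circ> tinl \<circ> target = proj2 \<circ> tinr \<circ> source"
    by (simp add: proj2_tinl proj2_tinr ahom)
  then show ?thesis by (simp add: fun_eq_iff)
qed

lemma balance2: "(target b * g) \<otimes> h - g \<otimes> (source b * h) \<in> J2"
  unfolding bal2_def by (rule cvec.span_base) blast

text \<open>Applied to a generator, \<open>F\<close> factors over the two legs; the terms then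
  differ only in the values at \<open>target b\<close> and \<open>source b\<close>, which agree, and
  in the order of factors.\<close>

lemma balanced_vanish:
  fixes F :: "('b \<otimes> 'a) \<otimes> ('b \<otimes> 'a) \<Rightarrow> 'd::complex_algebra_1"
  assumes "comm_alg TYPE('d)" "alg_hom F" "F \<circ> tinl \<circ> target = F \<circ> tinr \<circ> source"
    and "x \<in> J2"
  shows "F x = 0"
proof (rule span_vanish[OF _ _ \<open>x \<in> J2\<close>[unfolded bal2_def]])
  fix y assume "y \<in> {(target b * g) \<otimes> h - g \<otimes> (source b * h) | b g h. True}"
  then obtain b g h where y: "y = (target b * g) \<otimes> h - g \<otimes> (source b * h)" by blast
  have "F y = F (tinl (target b)) * F (tinl g) * F (tinr h) -
      F (tinl g) * (F (tinr (source b)) * F (tinr h))"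
    using assms(2) by (simp add: y clinear_diff flip: alg_hom_mult)
  also have "\<dots> = 0"
    using assms(3) comm_algD[OF assms(1), of "F (tinl g)"] by (simp add: fun_eq_iff mult.assoc)
  finally show "F y = 0" .
qed (use assms in simp)

text \<open>The first leg is \<open>c \<otimes> b = target b * (c \<otimes> 1)\<close>, so the
  balancing relation moves b into the second leg as \<open>source b\<close>.\<close>

lemma normal_form2: "\<exists>v. x - sec2 v \<in> J2"
proof (induction x rule: tensor22_induct)
  case (tensor c b x)
  have "(c \<otimes> b) \<otimes> x - sec2 (c \<otimes> (source b * x)) \<in> J2"
    using balance2[of b "tinl c" x]
    by (simp add: sec2_def tmap_tensor) (simp add: tinl_def tinr_def times_tensor_tensor)
  then show ?case by blast
next
  case (add x y)
  then obtain v w where "x - sec2 v \<in> J2" "y - sec2 w \<in> J2" by blast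
  then have "(x + y) - sec2 (v + w) \<in> J2"
    unfolding bal2_def using cvec.span_add[of "x - sec2 v" _ "y - sec2 w"]
    by (simp add: alg_hom_add[OF alg_hom_sec2] algebra_simps)
  then show ?case by blast
qed

lemma mem_bal2_iff: "x \<in> J2 \<longleftrightarrow> proj2 x = 0"
proof (rule kernel_eqI[OF _ _ _ _ proj2_sec2 normal_form2])
  show "proj2 x = 0" if "x \<in> {(target b * g) \<otimes> h - g \<otimes> (source b * h) | b g h. True}" for x
    using that proj2_balanced
    by (intro balanced_vanish) (auto simp: fun_eq_iff bal2_def intro: cvec.span_base)
qed (simp_all add: bal2_def)

section \<open>The quotients by \<open>bal3\<close> and \<open>bal22\<close>\<close>

lemma balance3:
  "(target b * g) \<otimes> u - g \<otimes> (tinl (source b) * u) \<in> J3"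
proof (induction u rule: tensor_induct)
  case (tensor h k)
  show ?case
    unfolding bal3_def by (rule cvec.span_base) (auto simp: tinl_def times_tensor_tensor)
next
  case (add u v)
  from cvec.span_add[OF add[unfolded bal3_def]] show ?case
    unfolding bal3_def by (simp add: tensor_add_right distrib_left add_diff_add)
qed

lemma tensor_mem_bal3:
  assumes "u \<in> J2"
  shows "g \<otimes> u \<in> J3"
  unfolding bal3_def
proof (rule span_mem_image[OF _ _ assms[unfolded bal2_def], of "\<lambda>u. g \<otimes> u"])
  fix y assume "y \<in> {(target b * g) \<otimes> h - g \<otimes> (source b * h) | b g h. True}"
  then obtain b h k where "y = (target b * h) \<otimes> k - h \<otimes> (source b * k)" by blast
  then have "g \<otimes> y = g \<otimes> (target b * h) \<otimes> k - g \<otimes> h \<otimes> (source b * k)"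
    by (simp add: tensor_diff_right)
  then show "g \<otimes> y \<in> cspan
      ({(target b * g) \<otimes> h \<otimes> k - g \<otimes> (source b * h) \<otimes> k | b g h k. True} \<union>
       {g \<otimes> (target b * h) \<otimes> k - g \<otimes> h \<otimes> (source b * k) | b g h k. True})"
    by (intro cvec.span_base) blast
qed (simp add: clinear_iff tensor_add_right tensor_scale_right)

text \<open>The \<open>B\<close> component of the first leg is pushed into the remaining two, which
  are then brought to normal form by themselves.\<close>

lemma normal_form3: "\<exists>v. x - tmap tinl sec2 v \<in> J3"
proof (induction x rule: tensor22_induct)
  case (tensor c b u)
  obtain v where v: "tinl (source b) * u - sec2 v \<in> J2"
    using normal_form2 by blast
  have "(c \<otimes> b) \<otimes> u - tinl c \<otimes> (tinl (source b) * u) \<in> J3"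
    using balance3[of b "tinl c" u]
    by (simp add: tinl_def[of c] tinr_def times_tensor_tensor)
  moreover have "tinl c \<otimes> (tinl (source b) * u) - tinl c \<otimes> sec2 v \<in> J3"
    using tensor_mem_bal3[OF v] by (simp add: tensor_diff_right)
  ultimately have "(c \<otimes> b) \<otimes> u - tinl c \<otimes> sec2 v \<in> J3"
    unfolding bal3_def using cvec.span_add by fastforce
  then show ?case by (intro exI[of _ "c \<otimes> v"]) (simp add: tmap_tensor)
next
  case (add x y)
  then obtain v w where "x - tmap tinl sec2 v \<in> J3" "y - tmap tinl sec2 w \<in> J3" by blast
  then have "(x + y) - tmap tinl sec2 (v + w) \<in> J3"
    unfolding bal3_def using cvec.span_add[of "x - tmap tinl sec2 v" _ "y - tmap tinl sec2 w"]
    by (simp add: clinear_add[OF clinear_tmap] algebra_simps)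
  then show ?case by blast
qed

lemma proj3_tensor: "proj3 (g \<otimes> u) = proj3 (tinl g) * tinr (proj2 u)"
proof -
  have "proj3 (g \<otimes> u) = proj3 (tinl g) * proj3 (tinr u)"
    by (simp flip: alg_hom_mult)
  moreover have "proj3 \<circ> tinr = tinr \<circ> proj2"
    by (simp add: proj3_def ahom)
  ultimately show ?thesis
    by (simp add: fun_eq_iff)
qed

lemma proj3_tinl: "proj3 \<circ> tinl = copair tinl (tinr \<circ> proj2 \<circ> tinl \<circ> source)"
  by (simp add: proj3_def ahom)

lemma mem_bal3_iff: "x \<in> J3 \<longleftrightarrow> proj3 x = 0"
proof (rule kernel_eqI[OF _ bal3_def _ _ _ normal_form3])
  fix x
  assume "x \<in> {(target b * g) \<otimes> h \<otimes> k - g \<otimes> (source b * h) \<otimes> k | b g h k. True} \<union>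
    {g \<otimes> (target b * h) \<otimes> k - g \<otimes> h \<otimes> (source b * k) | b g h k. True}"
  then consider
    (1) b g h k where "x = (target b * g) \<otimes> h \<otimes> k - g \<otimes> (source b * h) \<otimes> k"
  | (2) b g h k where "x = g \<otimes> ((target b * h) \<otimes> k - h \<otimes> (source b * k))"
    by (auto simp: tensor_diff_right)
  then show "proj3 x = 0"
  proof cases
    case 1
    have "proj3 \<circ> tinl \<circ> target = tinr \<circ> proj2 \<circ> tinl \<circ> source"
      by (simp add: proj3_tinl ahom)
    then have t: "proj3 (tinl (target b)) = tinr (proj2 (tinl (source b)))"
      by (simp add: fun_eq_iff)
    have "(source b * h) \<otimes> k = tinl (source b) * (h \<otimes> k)"
      by (simp add: tinl_def times_tensor_tensor)
    then show ?thesis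
      using comm_algD[where x="proj3 (tinl g)" and 'a="'b \<otimes> 'b \<otimes> 'b \<otimes> 'a"]
      by (simp add: 1 clinear_diff proj3_tensor alg_hom_mult t mult.assoc)
  next
    case 2
    then show ?thesis
      using mem_bal2_iff[of "(target b * h) \<otimes> k - h \<otimes> (source b * k)"] balance2[of b h k]
      by (simp add: proj3_tensor clinear_0[OF alg_hom_linear[OF alg_hom_tinr]])
  qed
next
  fix v
  have "proj3 \<circ> tinl \<circ> tinl = tinl"
    by (simp add: proj3_tinl ahom)
  then have [simp]: "proj3 (tinl (tinl c)) = tinl c" for c
    by (simp add: fun_eq_iff)
  have "proj3 \<circ> tmap tinl sec2 = id"
  proof (rule clinear_tensor_eqI)
    show "(proj3 \<circ> tmap tinl sec2) (c \<otimes> x) = id (c \<otimes> x)" for c x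
      by (simp add: tmap_tensor proj3_tensor proj2_sec2)
  qed (simp_all add: clinear_compose ahom clinear_tmap)
  then show "proj3 (tmap tinl sec2 v) = v" by (simp add: fun_eq_iff)
qed (simp_all add: clinear_tmap)

lemma mem_bal22_iff: "x \<in> J22 \<longleftrightarrow> tmap proj2 proj2 x = 0"
proof (rule kernel_eqI[OF _ bal22_def])
  show "tmap proj2 proj2 x = 0"
    if "x \<in> {x \<otimes> y | x y. x \<in> J2} \<union> {x \<otimes> y | x y. y \<in> J2}" for x
    using that by (auto simp: tmap_tensor mem_bal2_iff)
  show "tmap proj2 proj2 (tmap sec2 sec2 v) = v" for v
    by (induction v rule: tensor_induct)
      (simp_all add: tmap_tensor proj2_sec2 clinear_add[OF clinear_tmap])
  show "\<exists>v. x - tmap sec2 sec2 v \<in> J22" for x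
  proof (induction x rule: tensor_induct)
    case (tensor x y)
    obtain v w where vw: "x - sec2 v \<in> J2" "y - sec2 w \<in> J2"
      using normal_form2 by meson
    \<comment> \<open>The sum telescopes to the difference of the two pure tensors, one leg being
      replaced at a time.\<close>
    have "(x - sec2 v) \<otimes> y + sec2 v \<otimes> (y - sec2 w) \<in> J22"
      unfolding bal22_def
      by (intro cvec.span_add cvec.span_base UnI1 UnI2) (use vw in blast)+
    then have "x \<otimes> y - sec2 v \<otimes> sec2 w \<in> J22"
      by (simp add: tensor_diff_left tensor_diff_right)
    then show ?case by (intro exI[of _ "v \<otimes> w"]) (simp add: tmap_tensor)
  next
    case (add x y)
    then obtain v w where "x - tmap sec2 sec2 v \<in> J22" "y - tmap sec2 sec2 w \<in> J22" by blast
    then have "(x + y) - tmap sec2 sec2 (v + w) \<in> J22"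
      unfolding bal22_def using cvec.span_add[of "x - tmap sec2 sec2 v" _ "y - tmap sec2 sec2 w"]
      by (simp add: clinear_add[OF clinear_tmap] algebra_simps)
    then show ?case by blast
  qed
qed (simp_all add: clinear_tmap)

section \<open>The Hopf algebroid\<close>

text \<open>Composition of arrows in the coordinates of \<open>proj2\<close>: the triple (n, m, h)
  goes to (n m, h).\<close>

definition coproduct_arrow0 :: "'b \<otimes> 'a \<Rightarrow> 'b \<otimes> 'b \<otimes> 'a"
  where "coproduct_arrow0 = copair (cprod \<Delta>C tinl (tinr \<circ> tinl)) (tinr \<circ> tinr)"

text \<open>By \<open>mem_bal2_iff\<close> this fibre is a coset, so it is an element of the
  balanced tensor product.\<close>

definition coproduct_arrow :: "'b \<otimes> 'a \<Rightarrow> (('b \<otimes> 'a) \<otimes> ('b \<otimes> 'a)) set"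
  where "coproduct_arrow h = {x. proj2 x = coproduct_arrow0 h}"

lemma alg_hom_coproduct_arrow0 [ahom, simp]: "alg_hom coproduct_arrow0"
  by (simp add: coproduct_arrow0_def ahom)

lemma coproduct_arrow0_target: "coproduct_arrow0 \<circ> target = proj2 \<circ> tinr \<circ> target"
  by (simp add: coproduct_arrow0_def proj2_tinr ahom)

text \<open>A composite starts where its first arrow starts: (n m) h = n (m h), as n is
  nuclear.\<close>

lemma coproduct_arrow0_source: "coproduct_arrow0 \<circ> source = proj2 \<circ> tinl \<circ> source"
proof -
  have "coproduct_arrow0 \<circ> source = ((tinl \<circ> \<phi>) \<cdot> (tinr \<circ> tinl \<circ> \<phi>)) \<cdot> (tinr \<circ> tinr)"
    by (simp add: coproduct_arrow0_def copair_source cprod_quotient ahom)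
  also have "\<dots> = (tinl \<circ> \<phi>) \<cdot> ((tinr \<circ> tinl \<circ> \<phi>) \<cdot> (tinr \<circ> tinr))"
    by (rule nuclear_assoc1) (simp_all add: ahom nuclear_quotient)
  also have "(tinr \<circ> tinl \<circ> \<phi>) \<cdot> (tinr \<circ> tinr) = tinr \<circ> source"
    by (simp add: comp_source ahom)
  also have "(tinl \<circ> \<phi>) \<cdot> (tinr \<circ> source) = proj2 \<circ> tinl \<circ> source"
    by (simp add: proj2_tinl copair_source ahom)
  finally show ?thesis .
qed

lemma coproduct_arrow_nonempty: "coproduct_arrow h \<noteq> {}"
  using proj2_sec2 by (auto simp: coproduct_arrow_def)

lemma mod_by_bal2:
  "A \<noteq> {} \<Longrightarrow> (\<And>x. x \<in> A \<Longrightarrow> proj2 x = v) \<Longrightarrow> mod_by J2 A = {x. proj2 x = v}"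
  using mod_by_fiber[OF _ mem_bal2_iff] by simp

section \<open>Convolution as composition of arrows\<close>

context
  fixes f g :: "'b \<otimes> 'a \<Rightarrow> 'd::complex_algebra_1"
  assumes A: "comm_alg TYPE('d)" and f: "alg_hom f" and g: "alg_hom g"
    and composable: "f \<circ> target = g \<circ> source"
begin

text \<open>Any representative differs from the normal form by a balanced element, and
  \<open>copair f g\<close> kills such elements because \<open>f\<close> and \<open>g\<close> are
  composable. Thus \<open>conv\<close> takes the element of a singleton.\<close>

lemma copair_composable:
  assumes "x \<in> coproduct_arrow h"
  shows "copair f g x = (copair f g \<circ> sec2 \<circ> coproduct_arrow0) h"
proof -
  have "x - sec2 (coproduct_arrow0 h) \<in> J2"
    using assms by (simp add: mem_bal2_iff clinear_diff proj2_sec2 coproduct_arrow_def)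
  moreover have "copair f g \<circ> tinl \<circ> target = copair f g \<circ> tinr \<circ> source"
    using f g by (simp add: composable)
  ultimately have "copair f g (x - sec2 (coproduct_arrow0 h)) = 0"
    using A f g by (intro balanced_vanish) (simp_all add: ahom)
  then show ?thesis
    using f g by (simp add: clinear_diff)
qed

lemma conv_eq: "conv coproduct_arrow f g = copair f g \<circ> sec2 \<circ> coproduct_arrow0"
proof
  fix h
  have "copair f g ` coproduct_arrow h = {(copair f g \<circ> sec2 \<circ> coproduct_arrow0) h}"
    using copair_composable coproduct_arrow_nonempty[of h] by (auto simp: image_iff)
  then show "conv coproduct_arrow f g h = (copair f g \<circ> sec2 \<circ> coproduct_arrow0) h"
    by (simp add: conv_def copair_def)
qed

lemma copair_eq_conv: "x \<in> coproduct_arrow h \<Longrightarrow> copair f g x = conv coproduct_arrow f g h"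
  by (simp only: conv_eq copair_composable)

lemma alg_hom_conv: "alg_hom (conv coproduct_arrow f g)"
  using A f g by (simp add: conv_eq ahom)

lemma conv_target: "conv coproduct_arrow f g \<circ> target = g \<circ> target"
proof
  fix b
  \<comment> \<open>A convenient representative with trivial first leg, on which \<open>f\<close>
    contributes the factor 1.\<close>
  have "tinr (target b) \<in> coproduct_arrow (target b)"
    using coproduct_arrow0_target by (simp add: coproduct_arrow_def fun_eq_iff)
  from copair_eq_conv[OF this] show "(conv coproduct_arrow f g \<circ> target) b = (g \<circ> target) b"
    using f g by (simp add: tinr_def[of "target b"] copair_tensor alg_hom_one)
qed

lemma conv_source: "conv coproduct_arrow f g \<circ> source = f \<circ> source"
proof
  fix b
  have "tinl (source b) \<in> coproduct_arrow (source b)"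
    using coproduct_arrow0_source by (simp add: coproduct_arrow_def fun_eq_iff)
  from copair_eq_conv[OF this] show "(conv coproduct_arrow f g \<circ> source) b = (f \<circ> source) b"
    using f g by (simp add: tinl_def[of "source b"] copair_tensor alg_hom_one)
qed

end

lemmas conv_simps = ahom alg_hom_conv conv_source conv_target

text \<open>Both composites start at the source of \<open>p\<close> and end at the target of
  \<open>r\<close>.\<close>

lemma conv_assoc:
  fixes p q r :: "'b \<otimes> 'a \<Rightarrow> 'd::complex_algebra_1"
  assumes A: "comm_alg TYPE('d)" and "alg_hom p" "alg_hom q" "alg_hom r"
    and "p \<circ> target = q \<circ> source" "q \<circ> target = r \<circ> source"
  shows "conv coproduct_arrow (conv coproduct_arrow p q) r =
    conv coproduct_arrow p (conv coproduct_arrow q r)"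
  by (rule source_target_eqI[OF A]) (use assms in \<open>simp_all add: conv_simps\<close>)

text \<open>The legs \<open>p\<close>, \<open>q\<close>, \<open>r\<close> of \<open>proj3\<close>
  form the universal composable triple. Under \<open>proj3\<close> each side takes only the value of
  one bracketing of their composite, so the claim is associativity of composition.\<close>

lemma coring_coassoc:
  "mod_by J3 (tassoc ` tmap_set coproduct_arrow (\<lambda>h. {h}) (coproduct_arrow h)) =
   mod_by J3 (tmap_set (\<lambda>h. {h}) coproduct_arrow (coproduct_arrow h))"
proof -
  define p where "p = proj3 \<circ> tinl"
  define q where "q = proj3 \<circ> tinr \<circ> tinl"
  define r where "r = proj3 \<circ> tinr \<circ> tinr"
  let ?c = "conv coproduct_arrow"
  have hom: "alg_hom p" "alg_hom q" "alg_hom r"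
    by (simp_all add: p_def q_def r_def ahom)
  have proj3_tinr: "proj3 \<circ> tinr = tinr \<circ> proj2"
    by (simp add: proj3_def ahom)
  have pq: "p \<circ> target = q \<circ> source"
    unfolding p_def q_def by (simp add: proj3_tinl proj3_tinr ahom)
  have qr: "q \<circ> target = r \<circ> source"
    unfolding q_def r_def using proj2_balanced by (simp add: proj3_tinr fun_eq_iff)
  have proj3_eq: "proj3 = copair p (copair q r)"
    unfolding p_def q_def r_def by (simp add: copair3_eta)
  have hom': "alg_hom (?c p q)" "alg_hom (?c q r)"
    using hom pq qr by (simp_all add: conv_simps)
  have c1: "copair p q u = ?c p q k" and c2: "copair q r u = ?c q r k"
    if "u \<in> coproduct_arrow k" for u k
    using hom pq qr that by (simp_all add: copair_eq_conv)
  have c: "copair (?c p q) r x = ?c (?c p q) r k" "copair p (?c q r) x = ?c p (?c q r) k"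
    if "x \<in> coproduct_arrow k" for x k
    using hom hom' pq qr that by (intro copair_eq_conv; simp add: conv_simps)+
  have assoc: "?c (?c p q) r = ?c p (?c q r)"
    using hom pq qr by (intro conv_assoc) simp_all
  have l: "proj3 y = ?c p (?c q r) h"
    if y: "y \<in> tassoc ` tmap_set coproduct_arrow (\<lambda>h. {h}) (coproduct_arrow h)" for y
  proof -
    obtain z where z: "y = tassoc z" "z \<in> tmap_set coproduct_arrow (\<lambda>h. {h}) (coproduct_arrow h)"
      using y by blast
    have "\<exists>x\<in>coproduct_arrow h. tmap (copair p q) id z = tmap (?c p q) id x"
      by (rule tmap_set_fiber[OF _ _ _ _ _ _ z(2)]) (use hom hom' c1 in auto)
    then obtain x where x: "x \<in> coproduct_arrow h"
      "tmap (copair p q) id z = tmap (?c p q) id x" by blast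
    have "proj3 y = copair id r (tmap (copair p q) id z)"
      using hom by (simp add: proj3_eq z copair_tassoc copair_comp_tmap)
    also have "\<dots> = copair id r (tmap (?c p q) id x)"
      by (simp only: x)
    also have "\<dots> = copair (?c p q) r x"
      using hom hom' by (simp add: copair_comp_tmap)
    finally show ?thesis
      using c(1)[OF x(1)] assoc by simp
  qed
  have r: "proj3 y = ?c p (?c q r) h"
    if y: "y \<in> tmap_set (\<lambda>h. {h}) coproduct_arrow (coproduct_arrow h)" for y
  proof -
    have "\<exists>x\<in>coproduct_arrow h. tmap id (copair q r) y = tmap id (?c q r) x"
      by (rule tmap_set_fiber[OF _ _ _ _ _ _ y]) (use hom hom' c2 in auto)
    then obtain x where x: "x \<in> coproduct_arrow h"
      "tmap id (copair q r) y = tmap id (?c q r) x" by blast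
    have "proj3 y = copair p id (tmap id (copair q r) y)"
      using hom by (simp add: copair_comp_tmap proj3_eq)
    also have "\<dots> = copair p (?c q r) x"
      using hom hom' by (simp add: copair_comp_tmap x)
    finally show ?thesis
      using c(2)[OF x(1)] by simp
  qed
  show ?thesis
    by (subst (1 2) mod_by_fiber[OF _ mem_bal3_iff])
      (use l r coproduct_arrow_nonempty in \<open>auto simp: tmap_set_nonempty\<close>)
qed

lemma central_hopf_algebroid:
  "central_hopf_algebroid source target coproduct_arrow counit_arrow antipode_arrow"
proof
  note com = comm_algD[OF comm_alg_tensor[OF comm_quotient comm_base]]
  fix b b' :: 'a and h h' :: "'b \<otimes> 'a" and c :: complex
  have ne: "coproduct_arrow h \<noteq> {}" "coproduct_arrow h' \<noteq> {}"
    by (simp_all add: coproduct_arrow_nonempty)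
  show "b * b' = b' * b"
    by (rule comm_algD) simp
  show "alg_antihom antipode_arrow"
    using com by (simp add: alg_antihom_def alg_hom_one alg_hom_mult)
  show "source b * h = h * source b" "target b * h = h * target b"
    using com by blast+
  \<comment> \<open>The axioms on the coproduct alone compare fibres of \<open>proj2\<close>; they
    hold because \<open>proj2\<close> and \<open>coproduct_arrow0\<close> are algebra maps.\<close>
  show "\<exists>x. coproduct_arrow h = mod_by J2 {x}"
    by (rule exI[of _ "sec2 (coproduct_arrow0 h)"], subst mod_by_bal2[where v="coproduct_arrow0 h"])
      (simp_all add: proj2_sec2 coproduct_arrow_def)
  show "coproduct_arrow (h + h') =
      mod_by J2 {x + y | x y. x \<in> coproduct_arrow h \<and> y \<in> coproduct_arrow h'}"
    using ne by (subst mod_by_bal2[where v="coproduct_arrow0 (h + h')"])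
      (auto simp: coproduct_arrow_def alg_hom_add)
  show "coproduct_arrow (c *\<^sub>C h) = mod_by J2 {c *\<^sub>C x | x. x \<in> coproduct_arrow h}"
    using ne by (subst mod_by_bal2[where v="coproduct_arrow0 (c *\<^sub>C h)"])
      (auto simp: coproduct_arrow_def alg_hom_scale)
  show "coproduct_arrow (h * h') =
      mod_by J2 {x * y | x y. x \<in> coproduct_arrow h \<and> y \<in> coproduct_arrow h'}"
    using ne by (subst mod_by_bal2[where v="coproduct_arrow0 (h * h')"])
      (auto simp: coproduct_arrow_def alg_hom_mult)
  show "coproduct_arrow 1 = mod_by J2 {1}"
    by (subst mod_by_bal2[where v="coproduct_arrow0 1"])
      (auto simp: coproduct_arrow_def alg_hom_one)
  have "coproduct_arrow0 (source b * h * target b') =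
      proj2 (source b \<otimes> 1) * coproduct_arrow0 h * proj2 (1 \<otimes> target b')"
    using coproduct_arrow0_source coproduct_arrow0_target
    by (simp add: alg_hom_mult fun_eq_iff) (simp add: tinl_def tinr_def)
  then show "coproduct_arrow (source b * h * target b') =
      mod_by J2 {(source b \<otimes> 1) * x * (1 \<otimes> target b') | x. x \<in> coproduct_arrow h}"
    using ne by (subst mod_by_bal2[where v="coproduct_arrow0 (source b * h * target b')"])
      (auto simp: coproduct_arrow_def alg_hom_mult)
  have cs: "counit_arrow (source b) = b" and ct: "counit_arrow (target b) = b" for b
    using counit_arrow_source counit_arrow_target by (simp_all add: fun_eq_iff)
  have as: "antipode_arrow (source b) = target b" and at: "antipode_arrow (target b) = source b" for b
    using antipode_arrow_source antipode_arrow_target by (simp_all add: fun_eq_iff)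
  show "counit_arrow (source b * h * target b') = b * counit_arrow h * b'"
    by (simp add: alg_hom_mult cs ct)
  show "antipode_arrow (target b * h * source b') = target b' * antipode_arrow h * source b"
    using com by (simp add: alg_hom_mult as at) (metis mult.assoc)
  show "mod_by J3 (tassoc ` tmap_set coproduct_arrow (\<lambda>h. {h}) (coproduct_arrow h)) =
      mod_by J3 (tmap_set (\<lambda>h. {h}) coproduct_arrow (coproduct_arrow h))"
    by (rule coring_coassoc)
  \<comment> \<open>What remains are the unit laws and the inverse laws of composition, each checked
    on sources and targets.\<close>
  note arrow = counit_arrow_source counit_arrow_target antipode_arrow_source antipode_arrow_target
  have "conv coproduct_arrow (source \<circ> counit_arrow) id = id"
    by (rule source_target_eqI) (simp_all add: conv_simps comp_assoc arrow)
  then show "conv coproduct_arrow (source \<circ> counit_arrow) id h = h" by simp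
  have "conv coproduct_arrow id (target \<circ> counit_arrow) = id"
    by (rule source_target_eqI) (simp_all add: conv_simps comp_assoc arrow)
  then show "conv coproduct_arrow id (target \<circ> counit_arrow) h = h" by simp
  have "conv coproduct_arrow antipode_arrow id = target \<circ> counit_arrow"
    by (rule source_target_eqI) (simp_all add: conv_simps comp_assoc arrow)
  then show "conv coproduct_arrow antipode_arrow id h = target (counit_arrow h)" by simp
  have "conv coproduct_arrow id antipode_arrow = source \<circ> counit_arrow"
    by (rule source_target_eqI) (simp_all add: conv_simps comp_assoc arrow)
  then show "conv coproduct_arrow id antipode_arrow h = source (counit_arrow h)" by simp
qed simp_all

end

section \<open>Coherence\<close>

text \<open>Written as the map induced by two algebra maps, the flip is visibly an algebra map for
  commutative factors.\<close>

lemma tswap_mid_eq: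
  "tswap_mid = copair (tmap tinl tinl)
    (tmap tinr tinr :: 'c::complex_algebra_1 \<otimes> 'd::complex_algebra_1 \<Rightarrow>
      ('a::complex_algebra_1 \<otimes> 'c) \<otimes> ('b::complex_algebra_1 \<otimes> 'd))"
proof -
  let ?F = "tmap tinl tinl :: 'a \<otimes> 'b \<Rightarrow> ('a \<otimes> 'c) \<otimes> ('b \<otimes> 'd)"
  let ?G = "tmap tinr tinr :: 'c \<otimes> 'd \<Rightarrow> ('a \<otimes> 'c) \<otimes> ('b \<otimes> 'd)"
  have lin: "clinear ?F" "clinear ?G"
    by (simp_all add: clinear_tmap)
  have 1: "tlift (\<lambda>(c::'c) (d::'d). (a \<otimes> c) \<otimes> (b \<otimes> d)) = (\<lambda>y. ?F (a \<otimes> b) * ?G y)"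
    for a :: 'a and b :: 'b
    by (rule tlift_unique[OF clinear_mult_left[OF lin(2)]])
      (simp add: tmap_tensor times_tensor_tensor)
  have "tlift (\<lambda>(a::'a) (b::'b). ?F (a \<otimes> b) * ?G y) = (\<lambda>x. ?F x * ?G y)" for y
    by (rule tlift_unique[OF clinear_mult_right[OF lin(1)]]) simp
  then show ?thesis
    unfolding tswap_mid_def copair_def 1 by simp
qed

lemma alg_hom_tswap_mid:
  assumes "comm_alg TYPE('a::complex_algebra_1)" "comm_alg TYPE('b::complex_algebra_1)"
    "comm_alg TYPE('c::complex_algebra_1)" "comm_alg TYPE('d::complex_algebra_1)"
  shows "alg_hom (tswap_mid :: ('a \<otimes> 'b) \<otimes> ('c \<otimes> 'd) \<Rightarrow> _)"
  using assms by (simp add: tswap_mid_eq ahom)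

context commutative_quasi_pair
begin

text \<open>These rules bring composites of structure maps, restricted along source or target, into
  the form of loop words in \<open>B\<close>.\<close>

lemmas restrict_simps = ahom comp_assoc comp_cprod cprod_H_source cprod_H_target
  counit_arrow_source counit_arrow_target associator_source associator_target
  comp_coprodL comp_coprodR tmap_tinl tmap_tinr tmap_tinl_comp tmap_tinr_comp
  tassoc_comp

text \<open>The interchange law: a product of composites is the composite of the products. Its two
  sides are compared through \<open>tmap proj2 proj2\<close>.\<close>

lemma cocommutation:
  "mod_by J22 (tmap_set coproduct_arrow coproduct_arrow {coproduct_H h}) =
   mod_by J22 ((tswap_mid \<circ> tmap coproduct_H coproduct_H) ` coproduct_arrow h)"
proof -
  let ?P = "tmap proj2 proj2"
  \<comment> \<open>For two universal composable pairs, \<open>a\<close> is the product of the first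
    arrows, \<open>b\<close> that of the second arrows, and \<open>w\<close> the product of the two
    composites.\<close>
  define a where "a = tmap (proj2 \<circ> tinl) (proj2 \<circ> tinl) \<circ> coproduct_H"
  define b where "b = tmap (proj2 \<circ> tinr) (proj2 \<circ> tinr) \<circ> coproduct_H"
  define w where "w = tmap coproduct_arrow0 coproduct_arrow0 \<circ> coproduct_H"
  have hom: "alg_hom a" "alg_hom b" "alg_hom w"
    by (simp_all add: a_def b_def w_def ahom)
  have balanced: "proj2 \<circ> (tinl \<circ> target) = proj2 \<circ> (tinr \<circ> source)"
    using proj2_balanced by (simp add: fun_eq_iff)
  have ab: "a \<circ> target = b \<circ> source"
    unfolding a_def b_def
    by (simp add: tmap_coproduct clinear_compose cprod_H_source cprod_H_target comp_assoc balanced)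
  have conv_ab: "conv coproduct_arrow a b = w"
  proof (rule source_target_eqI)
    show "conv coproduct_arrow a b \<circ> source = w \<circ> source"
      using hom ab by (simp add: conv_source) (simp add: a_def w_def tmap_coproduct clinear_compose
        cprod_H_source comp_assoc coproduct_arrow0_source)
    show "conv coproduct_arrow a b \<circ> target = w \<circ> target"
      using hom ab by (simp add: conv_target) (simp add: b_def w_def tmap_coproduct clinear_compose
        cprod_H_target comp_assoc coproduct_arrow0_target)
  qed (use hom ab in \<open>simp_all add: alg_hom_conv\<close>)
  have "?P \<circ> (tswap_mid \<circ> tmap coproduct_H coproduct_H) = copair a b"
  proof (rule alg_hom_tensor_eqI)
    show "?P \<circ> (tswap_mid \<circ> tmap coproduct_H coproduct_H) \<circ> tinl = copair a b \<circ> tinl"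
      using hom by (simp add: comp_assoc tmap_tinl)
        (simp add: tswap_mid_eq ahom a_def tmap_comp_tmap)
    show "?P \<circ> (tswap_mid \<circ> tmap coproduct_H coproduct_H) \<circ> tinr = copair a b \<circ> tinr"
      using hom by (simp add: comp_assoc tmap_tinr)
        (simp add: tswap_mid_eq ahom b_def tmap_comp_tmap)
  qed (use hom in \<open>simp_all add: ahom alg_hom_tswap_mid\<close>)
  then have r: "?P x = w h"
    if "x \<in> (tswap_mid \<circ> tmap coproduct_H coproduct_H) ` coproduct_arrow h" for x
    using that hom ab copair_eq_conv[OF _ hom(1,2) ab]
    by (auto simp: fun_eq_iff conv_ab)
  have l: "?P x = w h"
    if "x \<in> tmap_set coproduct_arrow coproduct_arrow {coproduct_H h}" for x
    using tmap_set_fiber[OF _ _ _ _ _ _ that, of proj2 proj2 coproduct_arrow0 coproduct_arrow0]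
    by (simp add: coproduct_arrow_def w_def)
  show ?thesis
    by (subst (1 2) mod_by_fiber[OF _ mem_bal22_iff])
      (use l r coproduct_arrow_nonempty in \<open>auto simp: tmap_set_nonempty clinear_tmap\<close>)
qed

text \<open>Both sides start at x (y z), formed from the sources of three arrows, and end at (x y)
  z, formed from their targets.\<close>

lemma associator_natural:
  "conv coproduct_arrow (tmap source (tmap source source) \<circ> associator) (coprodL coproduct_H) =
   conv coproduct_arrow (coprodR coproduct_H) (tmap target (tmap target target) \<circ> associator)"
  by (rule source_target_eqI)
    (simp_all add: conv_simps restrict_simps coprodL_eq[of coproduct_H] coprodR_eq[of coproduct_H])

text \<open>The pentagon. Both chains of reassociations lead from x (y (z w)) to ((x y) z) w, and an
  arrow is determined by its two ends.\<close>

lemma associator_cocycle: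
  "conv coproduct_arrow
     (conv coproduct_arrow (tmap counit_arrow associator \<circ> coproduct_H)
       (tmap id (tassoc \<circ> tmap \<Delta>B id) \<circ> associator))
     (tmap id tassoc \<circ> tassoc \<circ> tmap associator counit_arrow \<circ> coproduct_H) =
   conv coproduct_arrow (tmap id (tmap id \<Delta>B) \<circ> associator)
     (tassoc \<circ> tmap \<Delta>B id \<circ> associator)"
  (is "conv _ (conv _ ?p1 ?p2) ?p3 = conv _ ?q1 ?q2")
proof -
  have hom: "alg_hom ?p1" "alg_hom ?p2" "alg_hom ?p3" "alg_hom ?q1" "alg_hom ?q2"
    by (simp_all add: ahom)
  note simps = restrict_simps comp_coproduct[where \<Delta>=coproduct_H] comp_coproduct[where \<Delta>="\<Delta>B"]
  \<comment> \<open>The intermediate vertices are x ((y z) w) and (x (y z)) w on the left side and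
    (x y) (z w) on the right side.\<close>
  have p12: "?p1 \<circ> target = ?p2 \<circ> source"
    by (simp add: simps)
  have p23: "?p2 \<circ> target = ?p3 \<circ> source"
    by (simp add: simps)
  have q12: "?q1 \<circ> target = ?q2 \<circ> source"
    by (simp add: simps)
  have s: "?p1 \<circ> source = ?q1 \<circ> source"
    by (simp add: simps)
  have t: "?p3 \<circ> target = ?q2 \<circ> target"
    by (simp add: simps)
  have A: "comm_alg TYPE('a \<otimes> 'a \<otimes> 'a \<otimes> 'a)"
    by simp
  have hom12: "alg_hom (conv coproduct_arrow ?p1 ?p2)"
    by (rule alg_hom_conv[OF A hom(1,2) p12])
  have p123: "conv coproduct_arrow ?p1 ?p2 \<circ> target = ?p3 \<circ> source"
    by (simp only: conv_target[OF A hom(1,2) p12] p23)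
  show ?thesis
    by (rule source_target_eqI[OF A alg_hom_conv[OF A hom12 hom(3) p123]
          alg_hom_conv[OF A hom(4,5) q12]])
      (simp_all only: conv_source[OF A hom12 hom(3) p123] conv_target[OF A hom12 hom(3) p123]
        conv_source[OF A hom(1,2) p12] conv_source[OF A hom(4,5) q12]
        conv_target[OF A hom(4,5) q12] s t)
qed

lemma coherent_hopf_2_algebra:
  "coherent_hopf_2_algebra \<Delta>B \<epsilon>B SB coproduct_H counit_H antipode_H source target
    coproduct_arrow counit_arrow antipode_arrow associator"
proof (intro coherent_hopf_2_algebra.intro coherent_hopf_2_algebra_axioms.intro)
  show "hopf_coquasigroup \<Delta>B \<epsilon>B SB" ..
  show "hopf_coquasigroup_hom coproduct_H counit_H \<Delta>B \<epsilon>B counit_arrow"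
  proof -
    have "\<Delta>B \<circ> counit_arrow = tmap counit_arrow counit_arrow \<circ> coproduct_H"
      by (rule source_target_eqI)
        (simp_all add: restrict_simps tmap_coproduct comp_coproduct[of id \<Delta>B, simplified, symmetric])
    moreover have "\<epsilon>B \<circ> counit_arrow = counit_H"
      by (rule source_target_eqI)
        (simp_all add: restrict_simps counit_H_source counit_H_target)
    ultimately show ?thesis
      by (simp add: hopf_coquasigroup_hom_def fun_eq_iff)
  qed
  show "hopf_coquasigroup_hom \<Delta>B \<epsilon>B coproduct_H counit_H source"
    using coproduct_H_source counit_H_source by (simp add: hopf_coquasigroup_hom_def fun_eq_iff)
  show "hopf_coquasigroup_hom \<Delta>B \<epsilon>B coproduct_H counit_H target"
    using coproduct_H_target counit_H_target by (simp add: hopf_coquasigroup_hom_def fun_eq_iff)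
  show "associator (target b) = coprodL \<Delta>B b" "associator (source b) = coprodR \<Delta>B b" for b
    using associator_target associator_source by (simp_all add: fun_eq_iff)
qed (simp_all only: hopf_coquasigroup_H central_hopf_algebroid cocommutation
    associator_natural associator_cocycle alg_hom_associator)

section \<open>The structure maps in Sweedler form\<close>

text \<open>The two formulas are the two bracketings of g n g^-1, which agree because the middle
  factor is nuclear.\<close>

lemma Ad_eq_lift:
  shows "Ad (\<phi> c) = tlift3 (\<lambda>x y z. (x * SB z) \<otimes> \<phi> y) (coprodL \<Delta>B c)"
    and "Ad (\<phi> c) = tlift3 (\<lambda>x y z. (x * SB z) \<otimes> \<phi> y) (coprodR \<Delta>B c)"
proof -
  have lift: "tlift3 (\<lambda>x y z. (x * SB z) \<otimes> \<phi> y) =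
      copair tinl (copair (tinr \<circ> \<phi>) (tinl \<circ> SB))"
    by (rule tlift3_eq_copair)
      (simp_all add: clinear_compose tinl_def tinr_def times_tensor_tensor)
  show "Ad (\<phi> c) = tlift3 (\<lambda>x y z. (x * SB z) \<otimes> \<phi> y) (coprodL \<Delta>B c)"
    by (simp add: lift Ad_def descend_phi nuclear_Ad cprod_cprod_left clinear_compose)
  moreover have "(tinl \<cdot> (tinr \<circ> \<phi>)) \<cdot> (tinl \<circ> SB) = tinl \<cdot> ((tinr \<circ> \<phi>) \<cdot> (tinl \<circ> SB))"
    by (rule nuclear_assoc2) (simp_all add: nuclear_quotient ahom)
  ultimately show "Ad (\<phi> c) = tlift3 (\<lambda>x y z. (x * SB z) \<otimes> \<phi> y) (coprodR \<Delta>B c)"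
    by (simp add: lift fun_eq_iff cprod_cprod_left cprod_cprod_right clinear_compose)
qed

text \<open>Each pure tensor in the Sweedler sum is a product of values of the four inclusions
  \<open>n\<close>, \<open>g\<close>, \<open>m\<close>, \<open>h\<close>. The nested lifts are
  evaluated from the inside by pulling out the factors that are constant there.\<close>

lemma coproduct_H_tensor:
  "coproduct_H (c \<otimes> b) =
    tlift (\<lambda>c1 c2. tlift (\<lambda>m c20. tlift (\<lambda>b1 b2. (c1 \<otimes> (m * b1)) \<otimes> (c20 \<otimes> b2)) (\<Delta>B b)) (Ad c2))
      (\<Delta>C c)"
proof -
  define n m :: "'b \<Rightarrow> ('b \<otimes> 'a) \<otimes> ('b \<otimes> 'a)" where "n = tinl \<circ> tinl" and "m = tinr \<circ> tinl"
  define g h :: "'a \<Rightarrow> ('b \<otimes> 'a) \<otimes> ('b \<otimes> 'a)" where "g = tinl \<circ> tinr" and "h = tinr \<circ> tinr"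
  have lin: "clinear n" "clinear m" "clinear g" "clinear h"
    by (simp_all add: n_def m_def g_def h_def clinear_compose)
  have "(c1 \<otimes> (x * b1)) \<otimes> (y \<otimes> b2) = n c1 * (g x * m y) * (g b1 * h b2)" for c1 x b1 y b2
    by (simp add: n_def m_def g_def h_def tinl_def tinr_def times_tensor_tensor one_tensor_def)
  moreover have "tlift (\<lambda>b1 b2. w * (g b1 * h b2)) (\<Delta>B b) = w * (g \<cdot> h) b" for w
    by (simp add: tlift_mult_left cbilinear_mult lin cprod_def copair_def)
  moreover have "tlift (\<lambda>x y. n c1 * (g x * m y) * w) X = n c1 * copair g m X * w" for c1 w X
    using cbilinear_mult[OF lin(3,2)]
    by (subst tlift_mult_right)
      (simp_all add: tlift_mult_left copair_def cbilinear_def clinear_iff distrib_left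
        mult_scaleC_right)
  moreover have "tlift (\<lambda>c1 c2. n c1 * copair g m (Ad c2) * w) X =
      copair n (copair g m \<circ> Ad) X * w" for w X
  proof -
    have "clinear (copair g m \<circ> Ad)"
      by (simp add: clinear_compose lin)
    from tlift_mult_right[OF cbilinear_mult[OF lin(1) this]] show ?thesis
      by (simp add: copair_def)
  qed
  ultimately show ?thesis
    unfolding coproduct_H_def
    by (simp add: copair_tensor clinear_compose lin flip: n_def m_def g_def h_def) (simp add: cprod_def)
qed

lemma antipode_H_tensor: "antipode_H (c \<otimes> b) = tlift (\<lambda>m c0. SC c0 \<otimes> SB (m * b)) (Ad c)"
proof -
  have "tlift (\<lambda>m c0. SC c0 \<otimes> SB (m * b)) =
      (\<lambda>x. copair (tinr \<circ> SB) (tinl \<circ> SC) x * tinr (SB b))"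
    by (rule tlift_unique) (simp_all add: clinear_mult_right clinear_compose copair_tensor,
      simp add: tinl_def tinr_def times_tensor_tensor B.antipode_mult)
  then show ?thesis
    by (simp add: antipode_H_def copair_tensor clinear_compose)
qed

lemma antipode_arrow_tensor:
  "antipode_arrow (c \<otimes> b) = tlift (\<lambda>b1 b2. (SC c * \<phi> b1) \<otimes> b2) (\<Delta>B b)"
proof -
  have "tlift (\<lambda>b1 (b2::'a). (SC c * \<phi> b1) \<otimes> b2) = (\<lambda>x. tinl (SC c) * tmap \<phi> id x)"
    by (rule tlift_unique) (simp_all add: clinear_mult_left clinear_tmap tmap_tensor,
      simp add: tinl_def times_tensor_tensor)
  then show ?thesis
    by (simp add: antipode_arrow_def copair_tensor clinear_compose) (simp add: source_def)
qed

text \<open>It suffices that the Sweedler expression has the right image under \<open>proj2\<close>,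
  since the coproduct was defined as a fibre.\<close>

lemma coproduct_arrow_tensor:
  "coproduct_arrow (c \<otimes> b) =
    mod_by J2 {tlift (\<lambda>c1 c2. (c1 \<otimes> 1) \<otimes> (c2 \<otimes> b)) (\<Delta>C c)}"
proof -
  have tl: "tlift (\<lambda>c1 c2. (c1 \<otimes> 1) \<otimes> (c2 \<otimes> b)) =
      (\<lambda>x. copair (tinl \<circ> tinl) (tinr \<circ> tinl) x * tinr (tinr b))"
    by (rule tlift_unique) (simp_all add: clinear_mult_right clinear_compose copair_tensor,
      simp add: tinl_def tinr_def times_tensor_tensor one_tensor_def)
  have "proj2 \<circ> copair (tinl \<circ> tinl) (tinr \<circ> tinl) = copair tinl (tinr \<circ> tinl)"
    by (simp add: comp_copair clinear_compose flip: comp_assoc)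
      (simp add: proj2_tinl proj2_tinr ahom)
  then have "proj2 (tlift (\<lambda>c1 c2. (c1 \<otimes> 1) \<otimes> (c2 \<otimes> b)) (\<Delta>C c)) = coproduct_arrow0 (c \<otimes> b)"
    using proj2_tinr unfolding tl
    by (simp add: alg_hom_mult coproduct_arrow0_def copair_tensor clinear_compose fun_eq_iff)
      (simp add: cprod_def)
  then show ?thesis
    by (subst mod_by_bal2[where v="coproduct_arrow0 (c \<otimes> b)"]) (auto simp: coproduct_arrow_def)
qed

end

theorem theorem5p8:
  fixes \<Delta>B :: "'b::complex_algebra_1 \<Rightarrow> 'b \<otimes> 'b" and \<epsilon>B :: "'b \<Rightarrow> complex" and SB :: "'b \<Rightarrow> 'b"
    and \<Delta>C :: "'c::complex_algebra_1 \<Rightarrow> 'c \<otimes> 'c" and \<epsilon>C :: "'c \<Rightarrow> complex" and SC :: "'c \<Rightarrow> 'c"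
    and \<phi> :: "'b \<Rightarrow> 'c"
  assumes "quasi_coassociative_pair \<Delta>B \<epsilon>B SB \<Delta>C \<epsilon>C SC \<phi>"
    and "\<And>x y :: 'b. x * y = y * x"
  shows "\<exists>(Ad :: 'c \<Rightarrow> 'b \<otimes> 'c)
           (\<Delta>H :: 'c \<otimes> 'b \<Rightarrow> ('c \<otimes> 'b) \<otimes> ('c \<otimes> 'b)) (\<epsilon>H :: 'c \<otimes> 'b \<Rightarrow> complex)
           (SH :: 'c \<otimes> 'b \<Rightarrow> 'c \<otimes> 'b) (s :: 'b \<Rightarrow> 'c \<otimes> 'b) (t :: 'b \<Rightarrow> 'c \<otimes> 'b)
           (\<Delta> :: 'c \<otimes> 'b \<Rightarrow> (('c \<otimes> 'b) \<otimes> ('c \<otimes> 'b)) set) (\<epsilon> :: 'c \<otimes> 'b \<Rightarrow> 'b)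
           (S :: 'c \<otimes> 'b \<Rightarrow> 'c \<otimes> 'b) (\<alpha> :: 'c \<otimes> 'b \<Rightarrow> 'b \<otimes> 'b \<otimes> 'b).
      clinear Ad \<and>
      (\<forall>c. Ad (\<phi> c) = tlift3 (\<lambda>x y z. (x * SB z) \<otimes> \<phi> y) (coprodL \<Delta>B c)) \<and>
      (\<forall>c. Ad (\<phi> c) = tlift3 (\<lambda>x y z. (x * SB z) \<otimes> \<phi> y) (coprodR \<Delta>B c)) \<and>
      (\<forall>c c' (b :: 'b) b'. (\<phi> c \<otimes> b) * (\<phi> c' \<otimes> b') = \<phi> (c * c') \<otimes> (b * b')) \<and>
      (\<forall>c b. \<Delta>H (\<phi> c \<otimes> b) =
         tlift (\<lambda>c1 c2. tlift (\<lambda>m c20. tlift (\<lambda>b1 b2. (c1 \<otimes> (m * b1)) \<otimes> (c20 \<otimes> b2))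
           (\<Delta>B b)) (Ad c2)) (\<Delta>C (\<phi> c))) \<and>
      (\<forall>c b. \<epsilon>H (\<phi> c \<otimes> b) = \<epsilon>C (\<phi> c) * \<epsilon>B b) \<and>
      (\<forall>c b. SH (\<phi> c \<otimes> b) = tlift (\<lambda>m c0. SC c0 \<otimes> SB (m * b)) (Ad (\<phi> c))) \<and>
      (\<forall>b. s b = tlift (\<lambda>b1 b2. \<phi> b1 \<otimes> b2) (\<Delta>B b)) \<and>
      (\<forall>b. t b = 1 \<otimes> b) \<and>
      (\<forall>c b. \<Delta> (\<phi> c \<otimes> b) =
         mod_by (bal2 s t) {tlift (\<lambda>c1 c2. (c1 \<otimes> 1) \<otimes> (c2 \<otimes> b)) (\<Delta>C (\<phi> c))}) \<and>
      (\<forall>c b. \<epsilon> (\<phi> c \<otimes> b) = \<epsilon>C (\<phi> c) *\<^sub>C b) \<and>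
      (\<forall>c b. S (\<phi> c \<otimes> b) = tlift (\<lambda>b1 b2. (SC (\<phi> c) * \<phi> b1) \<otimes> b2) (\<Delta>B b)) \<and>
      (\<forall>c b. \<alpha> (\<phi> c \<otimes> b) = coassociator \<Delta>B SB c * coprodL \<Delta>B b) \<and>
      coherent_hopf_2_algebra \<Delta>B \<epsilon>B SB \<Delta>H \<epsilon>H SH s t \<Delta> \<epsilon> S \<alpha>"
proof -
  interpret commutative_quasi_pair \<Delta>B \<epsilon>B SB \<Delta>C \<epsilon>C SC \<phi>
    using assms by (simp add: commutative_quasi_pair_def commutative_quasi_pair_axioms_def
        comm_alg_def)
  show ?thesis
  proof (rule exI[of _ Ad], rule exI[of _ coproduct_H], rule exI[of _ counit_H], rule exI[of _ antipode_H],
      rule exI[of _ source], rule exI[of _ target], rule exI[of _ coproduct_arrow], rule exI[of _ counit_arrow],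
      rule exI[of _ antipode_arrow], rule exI[of _ associator], intro conjI allI)
    show "Ad (\<phi> c) = tlift3 (\<lambda>x y z. (x * SB z) \<otimes> \<phi> y) (coprodL \<Delta>B c)"
      "Ad (\<phi> c) = tlift3 (\<lambda>x y z. (x * SB z) \<otimes> \<phi> y) (coprodR \<Delta>B c)" for c
      by (fact Ad_eq_lift)+
    show "(\<phi> c \<otimes> b) * (\<phi> c' \<otimes> b') = \<phi> (c * c') \<otimes> (b * b')" for c c' and b b' :: 'b
      by (simp add: times_tensor_tensor alg_hom_mult)
    show "counit_H (\<phi> c \<otimes> b) = \<epsilon>C (\<phi> c) * \<epsilon>B b" for c b
      by (simp add: counit_H_def copair_tensor)
    show "source b = tlift (\<lambda>b1 b2. \<phi> b1 \<otimes> b2) (\<Delta>B b)" for b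
      by (simp add: source_def tmap_def)
    show "target b = (1 :: 'c) \<otimes> b" for b :: 'b
      by (simp add: tinr_def)
    show "counit_arrow (\<phi> c \<otimes> b) = \<epsilon>C (\<phi> c) *\<^sub>C b" for c b
      by (simp add: counit_arrow_def copair_tensor C.unit_point_def mult_scaleC_left)
    show "associator (\<phi> c \<otimes> b) = coassociator \<Delta>B SB c * coprodL \<Delta>B b" for c b
      by (simp add: associator_def copair_tensor nuclear_coassociator descend_phi)
  qed (simp_all only: alg_hom_linear alg_hom_Ad coproduct_H_tensor antipode_H_tensor
      coproduct_arrow_tensor antipode_arrow_tensor coherent_hopf_2_algebra)
qed

end
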